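(* Let $-A$ be the generator of a bounded $C_0$-semigroup $(e^{-tA})_{t\ge 0}$ on a complex Banach space $X$, and let $(g_t)_{t>0}$ be a family of completely monotone functions such that for every $t>0$, $$g_t(0)=1,\quad g_t'(0)=-1,\quad g_t''(0)<\infty,\quad |g_t'''(0)|<\infty,\quad g_t''''(0)<\infty .$$ Let $M:=\sup_{t\ge 0}\|e^{-tA}\|$. Then for all $t>0$, $n\in\mathbb N$ and $x\in\mathrm{dom}(A^3)$, $$\left\|g_t^n(tA/n)x-e^{-tA}x-(2n)^{-1}(g_t''(0)-1)\,t^2e^{-tA}A^2x\right\|\le M\,C(g_t)\,t^3n^{-3/2}\|A^3x\|,$$ where $$C(g_t)=\left(\frac{(g_t''(0)-1)(g_t''''(0)-1)}{2}\right)^{1/2}.$$ Moreover, for all $x\in\mathrm{dom}(A^4)$, $t>0$ and $n\in\mathbb N$, $$\left\|g_t^n(tA/n)x-e^{-tA}x-(2n)^{-1}(g_t''(0)-1)\,t^2e^{-tA}A^2x\right\|\le M\,C_1(g_t)\,n^{-2}t^3\left(\|A^3x\|+t\|A^4x\|\right),$$ where $C_1(g_t)=g_t''''(0)-1$.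
   Context: A function $g\in C^\infty(0,\infty)$, $g\ge 0$, is completely monotone if $(-1)^k g^{(k)}(z)\ge 0$ for all $k\in\mathbb N$, $z>0$; by Bernstein's theorem $g(z)=\int_{[0,\infty)}e^{-zs}\,\nu(ds)$, $z>0$, for a unique positive Borel measure $\nu$ on $[0,\infty)$. One writes $g^{(k)}(0):=\lim_{z\to0+}g^{(k)}(z)$ (possibly infinite). If $g$ is bounded and $-A$ generates a bounded $C_0$-semigroup, then $g(A)$ is defined by the Hille–Phillips calculus: $g(A)x=\int_{[0,\infty)}e^{-sA}x\,\nu(ds)$, $x\in X$. The operator $g_t^n(tA/n)$ is the one obtained by applying this to the bounded completely monotone function $z\mapsto (g_t(tz/n))^n$; it equals the $n$-th power of $g_t(tA/n)=\int_{[0,\infty)}e^{-s(t/n)A}\,\nu_t(ds)$, where $\nu_t$ is the representing measure of $g_t$. *)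

theory Defs
  imports "HOL-Analysis.Analysis"
begin

section \<open>Complex Banach spaces\<close>

text \<open>The distribution has no complex normed spaces. The scalar multiplication by complex numbers
  extends the given real one, so that all real notions of the library remain applicable.\<close>

class complex_normed_vector = real_normed_vector +
  fixes scaleC :: "complex \<Rightarrow> 'a \<Rightarrow> 'a"  (infixr \<open>*\<^sub>C\<close> 75)
  assumes scaleC_add_right: "c *\<^sub>C (x + y) = c *\<^sub>C x + c *\<^sub>C y"
    and scaleC_add_left: "(c + d) *\<^sub>C x = c *\<^sub>C x + d *\<^sub>C x"
    and scaleC_scaleC: "c *\<^sub>C d *\<^sub>C x = (c * d) *\<^sub>C x"
    and scaleR_scaleC: "r *\<^sub>R x = complex_of_real r *\<^sub>C x"
    and norm_scaleC: "norm (c *\<^sub>C x) = cmod c * norm x"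

class complex_banach = complex_normed_vector + banach

instantiation complex :: complex_banach
begin

definition scaleC_complex :: "complex \<Rightarrow> complex \<Rightarrow> complex" where
  "scaleC_complex c x = c * x"

instance
  by standard (auto simp: scaleC_complex_def algebra_simps norm_mult scaleR_conv_of_real)

end


section \<open>Bounded \<open>C\<^sub>0\<close>-semigroups and their generators\<close>

text \<open>Semigroups are indexed by \<^typ>\<open>real\<close>; only the values at nonnegative times matter.\<close>

definition bounded_C0_semigroup :: "(real \<Rightarrow> 'a::complex_banach \<Rightarrow> 'a) \<Rightarrow> bool" where
  "bounded_C0_semigroup T \<longleftrightarrow>
     (\<forall>t\<ge>0. bounded_linear (T t) \<and> (\<forall>c x. T t (c *\<^sub>C x) = c *\<^sub>C T t x)) \<and>
     (\<forall>x. T 0 x = x) \<and>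
     (\<forall>s\<ge>0. \<forall>t\<ge>0. \<forall>x. T (s + t) x = T s (T t x)) \<and>
     (\<forall>x. ((\<lambda>t. T t x) \<longlongrightarrow> x) (at_right 0)) \<and>
     (\<exists>K. \<forall>t\<ge>0. onorm (T t) \<le> K)"

text \<open>An unbounded operator is given by its domain \<open>D\<close> and a total function \<open>B\<close> whose values
  outside \<open>D\<close> are irrelevant.\<close>

definition is_generator ::
    "'a::complex_banach set \<Rightarrow> ('a \<Rightarrow> 'a) \<Rightarrow> (real \<Rightarrow> 'a \<Rightarrow> 'a) \<Rightarrow> bool" where
  "is_generator D B T \<longleftrightarrow>
     D = {x. \<exists>y. ((\<lambda>h. (T h x - x) /\<^sub>R h) \<longlongrightarrow> y) (at_right 0)} \<and>
     (\<forall>x\<in>D. ((\<lambda>h. (T h x - x) /\<^sub>R h) \<longlongrightarrow> B x) (at_right 0))"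

fun dom_power :: "'a set \<Rightarrow> ('a \<Rightarrow> 'a) \<Rightarrow> nat \<Rightarrow> 'a set" where
  "dom_power D A 0 = UNIV"
| "dom_power D A (Suc k) = {x \<in> dom_power D A k. (A ^^ k) x \<in> D}"


section \<open>Completely monotone functions\<close>

text \<open>Values at nonpositive arguments are irrelevant.\<close>

definition completely_monotone :: "(real \<Rightarrow> real) \<Rightarrow> bool" where
  "completely_monotone g \<longleftrightarrow>
     (\<forall>k. \<forall>z>0. (deriv ^^ k) g field_differentiable at z \<and> 0 \<le> (- 1) ^ k * (deriv ^^ k) g z)"

text \<open>For completely monotone \<open>g\<close> all derivatives are monotone on the positive half-line, so the
  limit always exists in the extended reals.\<close>

definition deriv_at_0 :: "nat \<Rightarrow> (real \<Rightarrow> real) \<Rightarrow> ereal" where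
  "deriv_at_0 k g = Lim (at_right 0) (\<lambda>z. ereal ((deriv ^^ k) g z))"

definition represents :: "real measure \<Rightarrow> (real \<Rightarrow> real) \<Rightarrow> bool" where
  "represents \<nu> g \<longleftrightarrow>
     sets \<nu> = sets (restrict_space borel {0..}) \<and>
     (\<forall>z>0. has_bochner_integral \<nu> (\<lambda>s. exp (- (z * s))) (g z))"

text \<open>Every completely monotone function has exactly one representing measure (Bernstein), so the
  choice operator selects that one.\<close>

definition representing_measure :: "(real \<Rightarrow> real) \<Rightarrow> real measure" where
  "representing_measure g = (SOME \<nu>. represents \<nu> g)"


section \<open>The Hille--Phillips calculus\<close>

text \<open>The library's \<^const>\<open>has_bochner_integral\<close> and \<^const>\<open>lebesgue_integral\<close> require a second
  countable, i.e. separable, target space. The following are the same definitions without that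
  restriction.\<close>

definition has_Bochner_integral ::
    "'b measure \<Rightarrow> ('b \<Rightarrow> 'a::real_normed_vector) \<Rightarrow> 'a \<Rightarrow> bool" where
  "has_Bochner_integral \<mu> f y \<longleftrightarrow>
     f \<in> borel_measurable \<mu> \<and>
     (\<exists>s. (\<forall>i::nat. Bochner_Integration.simple_bochner_integrable \<mu> (s i)) \<and>
          (\<lambda>i. \<integral>\<^sup>+\<omega>. ennreal (norm (f \<omega> - s i \<omega>)) \<partial>\<mu>) \<longlonglongrightarrow> 0 \<and>
          (\<lambda>i. Bochner_Integration.simple_bochner_integral \<mu> (s i)) \<longlonglongrightarrow> y)"

definition Bochner_integral :: "'b measure \<Rightarrow> ('b \<Rightarrow> 'a::real_normed_vector) \<Rightarrow> 'a" where
  "Bochner_integral \<mu> f =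
     (if \<exists>y. has_Bochner_integral \<mu> f y then THE y. has_Bochner_integral \<mu> f y else 0)"

text \<open>\<open>hille_phillips T g\<close> is \<open>g(A)\<close>, where \<open>-A\<close> is the generator of the bounded semigroup \<open>T\<close> and
  \<open>g\<close> is bounded and completely monotone.\<close>

definition hille_phillips ::
    "(real \<Rightarrow> 'a::complex_banach \<Rightarrow> 'a) \<Rightarrow> (real \<Rightarrow> real) \<Rightarrow> 'a \<Rightarrow> 'a" where
  "hille_phillips T g x = Bochner_integral (representing_measure g) (\<lambda>s. T s x)"


section \<open>The constants\<close>

definition C_const :: "(real \<Rightarrow> real) \<Rightarrow> real" where
  "C_const g =
     sqrt ((real_of_ereal (deriv_at_0 2 g) - 1) * (real_of_ereal (deriv_at_0 4 g) - 1) / 2)"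

definition C1_const :: "(real \<Rightarrow> real) \<Rightarrow> real" where
  "C1_const g = real_of_ereal (deriv_at_0 4 g) - 1"

end

theory Submission
  imports Defs "HOL-Probability.Probability"
begin

text \<open>
Both estimates come from integrating one Taylor expansion. If \<open>\<nu>\<close> represents \<open>h(z) = g\<^sub>t(tz/n)\<^sup>n\<close>, then
\<open>h(A)x\<close> is the integral of the orbit \<open>s \<mapsto> e\<^sup>-\<^sup>s\<^sup>Ax\<close> against \<open>\<nu>\<close>, and expanding the orbit at \<open>s = t\<close> to order
\<open>p\<close> leaves an error of norm at most \<open>M \<bar>s - t\<bar>\<^sup>p \<parallel>A\<^sup>px\<parallel> / p!\<close>. The estimates are therefore statements about
the central moments of \<open>\<nu>\<close>. They are those of the law of \<open>S = (t/n)(X\<^sub>1 + \<dots> + X\<^sub>n)\<close> with independent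
\<open>X\<^sub>i\<close> of Laplace transform \<open>g\<^sub>t\<close> and mean \<open>1\<close>: the variance is \<open>t\<^sup>2(g\<^sub>t''(0) - 1)/n\<close>, which produces the
correction term, the third central moment is of order \<open>n\<^sup>-\<^sup>2\<close>, and the fourth is at most
\<open>3t\<^sup>4(g\<^sub>t''''(0) - 1)/n\<^sup>2\<close>. For \<open>p = 3\<close> the Cauchy--Schwarz inequality bounds the absolute third
moment by the geometric mean of the second and the fourth, hence the rate \<open>n\<^sup>-\<^sup>3\<^sup>/\<^sup>2\<close>. For \<open>p = 4\<close> the cubic
term of the expansion is itself of order \<open>n\<^sup>-\<^sup>2\<close> and joins the error.

Three ingredients make this rigorous.

\<^item> The calculus integrates against a chosen representing measure, so one has to exist. This is
Bernstein's theorem (lemma \<open>Bernstein\<close>). The Taylor series of \<open>h\<close> about \<open>b\<close> has nonnegative terms to the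
left of \<open>b\<close>; those terms at distance \<open>b\<close> are the weights of a discrete probability measure on multiples of
\<open>1/b\<close> whose transform at \<open>z\<close> is \<open>h(b - b e\<^sup>-\<^sup>z\<^sup>/\<^sup>b)\<close>. As \<open>b \<rightarrow> \<infinity>\<close> these measures are tight, and a weak
limit represents \<open>h\<close>.

\<^item> The moments of any representing measure are read off from the derivatives of \<open>h\<close> at \<open>0+\<close>
(lemma \<open>represents_central_moments\<close>). Centering at \<open>t\<close> multiplies the transform by \<open>e\<^sup>t\<^sup>z\<close>, and
\<open>e\<^sup>t\<^sup>zh(z) = (e\<^sup>t\<^sup>z\<^sup>/\<^sup>ng\<^sub>t(tz/n))\<^sup>n\<close> is the power of a function with vanishing first derivative at \<open>0+\<close>, for
which the first four derivatives of the power are short (lemma \<open>has_jet_power\<close>).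

\<^item> The space may be nonseparable, where sums of measurable functions need not be measurable. The
estimate (lemma \<open>has_Bochner_integral_dist_le\<close>) therefore compares simple approximations of the orbit
with simple approximations of the Taylor polynomial and never integrates their difference.
\<close>


section \<open>Derivatives on the positive half-line\<close>

text \<open>Successive derivatives as an explicit family, so that they are computed with the rules for
\<^const>\<open>has_field_derivative\<close> instead of by rewriting iterates of \<^const>\<open>deriv\<close>.\<close>

definition has_derivs :: "(real \<Rightarrow> real) \<Rightarrow> (nat \<Rightarrow> real \<Rightarrow> real) \<Rightarrow> bool" where
  "has_derivs f F \<longleftrightarrow> (\<forall>z>0. F 0 z = f z) \<and>
     (\<forall>k. \<forall>z>0. (F k has_real_derivative F (Suc k) z) (at z))"

lemma has_derivs_0: "has_derivs f F \<Longrightarrow> z > 0 \<Longrightarrow> F 0 z = f z"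
  by (simp add: has_derivs_def)

lemma has_derivs_Suc:
  "has_derivs f F \<Longrightarrow> z > 0 \<Longrightarrow> (F k has_real_derivative F (Suc k) z) (at z)"
  by (simp add: has_derivs_def)

lemma eventually_nhds_pos: "z > (0::real) \<Longrightarrow> (\<And>w. w > 0 \<Longrightarrow> P w) \<Longrightarrow> eventually P (nhds z)"
  using eventually_nhds_in_open[of "{0<..}" z] by (auto elim: eventually_mono)

lemma has_derivs_higher_deriv:
  assumes "has_derivs f F" "z > 0"
  shows "(deriv ^^ k) f z = F k z"
  using assms(2)
proof (induction k arbitrary: z)
  case 0
  then show ?case using has_derivs_0[OF assms(1)] by simp
next
  case (Suc k)
  have "deriv ((deriv ^^ k) f) z = deriv (F k) z"
    by (intro deriv_cong_ev eventually_nhds_pos Suc) auto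
  also have "\<dots> = F (Suc k) z"
    by (intro DERIV_imp_deriv has_derivs_Suc[OF assms(1)] Suc)
  finally show ?case by simp
qed

lemma completely_monotone_iff:
  assumes "has_derivs f F"
  shows "completely_monotone f \<longleftrightarrow> (\<forall>k. \<forall>z>0. 0 \<le> (- 1) ^ k * F k z)"
proof -
  have "(deriv ^^ k) f field_differentiable at z" if "z > 0" for k z
  proof -
    have "((deriv ^^ k) f has_real_derivative F (Suc k) z) (at z) \<longleftrightarrow>
        (F k has_real_derivative F (Suc k) z) (at z)"
      using that by (intro DERIV_cong_ev eventually_nhds_pos has_derivs_higher_deriv[OF assms]) auto
    then show ?thesis
      using has_derivs_Suc[OF assms that] field_differentiable_def by blast
  qed
  then show ?thesis
    by (simp add: completely_monotone_def has_derivs_higher_deriv[OF assms])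
qed

lemma completely_monotoneD:
  "completely_monotone f \<Longrightarrow> z > 0 \<Longrightarrow> 0 \<le> (- 1) ^ k * (deriv ^^ k) f z"
  by (simp add: completely_monotone_def)

lemma completely_monotone_has_derivs:
  "completely_monotone f \<Longrightarrow> has_derivs f (\<lambda>k. (deriv ^^ k) f)"
  by (simp add: completely_monotone_def has_derivs_def field_differentiable_derivI)

lemma has_derivs_mult:
  assumes f: "has_derivs f F" and g: "has_derivs g G"
  shows "has_derivs (\<lambda>z. f z * g z)
    (\<lambda>k z. \<Sum>i\<le>k. real (k choose i) * F i z * G (k - i) z)"
  unfolding has_derivs_def
proof (intro conjI allI impI)
  fix z :: real assume z: "z > 0"
  show "(\<Sum>i\<le>0. real (0 choose i) * F i z * G (0 - i) z) = f z * g z"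
    using has_derivs_0[OF f z] has_derivs_0[OF g z] by simp
next
  fix k and z :: real assume z: "z > 0"
  have "((\<lambda>z. \<Sum>i\<le>k. real (k choose i) * F i z * G (k - i) z) has_real_derivative
      (\<Sum>i\<le>k. real (k choose i) * (F i z * G (Suc (k - i)) z + F (Suc i) z * G (k - i) z))) (at z)"
    by (auto intro!: derivative_eq_intros has_derivs_Suc[OF f z] has_derivs_Suc[OF g z]
        simp: algebra_simps)
  also have "(\<Sum>i\<le>k. real (k choose i) * (F i z * G (Suc (k - i)) z + F (Suc i) z * G (k - i) z)) =
     (\<Sum>i\<le>Suc k. real (Suc k choose i) * F i z * G (Suc k - i) z)"
  proof -
    have split: "(\<Sum>i\<le>k. real (k choose i) * F i z * G (Suc (k - i)) z) =
      F 0 z * G (Suc k) z + (\<Sum>i\<le>k. real (k choose Suc i) * F (Suc i) z * G (k - i) z)"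
    proof -
      have "(\<Sum>i\<le>k. real (k choose i) * F i z * G (Suc (k - i)) z) =
          (\<Sum>i\<le>Suc k. real (k choose i) * F i z * G (Suc k - i) z)"
        by (simp add: Suc_diff_le)
      also have "\<dots> = F 0 z * G (Suc k) z + (\<Sum>i\<le>k. real (k choose Suc i) * F (Suc i) z * G (k - i) z)"
        by (subst sum.atMost_Suc_shift) simp
      finally show ?thesis .
    qed
    have "(\<Sum>i\<le>Suc k. real (Suc k choose i) * F i z * G (Suc k - i) z) =
      F 0 z * G (Suc k) z + (\<Sum>i\<le>k. real (Suc k choose Suc i) * F (Suc i) z * G (k - i) z)"
      by (subst sum.atMost_Suc_shift) simp
    then show ?thesis
      using split by (simp add: algebra_simps sum.distrib)
  qed
  finally show "((\<lambda>z. \<Sum>i\<le>k. real (k choose i) * F i z * G (k - i) z) has_real_derivative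
      (\<Sum>i\<le>Suc k. real (Suc k choose i) * F i z * G (Suc k - i) z)) (at z)" .
qed

lemma has_derivs_scale:
  assumes f: "has_derivs f F" and c: "c > 0"
  shows "has_derivs (\<lambda>z. f (c * z)) (\<lambda>k z. c ^ k * F k (c * z))"
  unfolding has_derivs_def
proof (intro conjI allI impI)
  fix z :: real assume z: "z > 0"
  show "c ^ 0 * F 0 (c * z) = f (c * z)"
    using has_derivs_0[OF f] c z by simp
next
  fix k and z :: real assume z: "z > 0"
  have "(F k has_real_derivative F (Suc k) (c * z)) (at (c * z))"
    using has_derivs_Suc[OF f] c z by simp
  then have "((\<lambda>z. F k (c * z)) has_real_derivative F (Suc k) (c * z) * c) (at z)"
    by (rule DERIV_chain2) (auto intro!: derivative_eq_intros)
  from DERIV_cmult[OF this, of "c ^ k"]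
  show "((\<lambda>z. c ^ k * F k (c * z)) has_real_derivative c ^ Suc k * F (Suc k) (c * z)) (at z)"
    by (simp add: ac_simps)
qed

lemma has_derivs_exp: "has_derivs (\<lambda>z. exp (t * z)) (\<lambda>k z. t ^ k * exp (t * z))"
  unfolding has_derivs_def by (auto intro!: derivative_eq_intros simp: ac_simps)

lemma has_derivs_const: "has_derivs (\<lambda>z. c) (\<lambda>k z. if k = 0 then c else 0)"
  unfolding has_derivs_def by auto

text \<open>The sign \<open>(-1)\<^sup>k\<close> splits over the factors of each term of Leibniz' rule.\<close>

lemma completely_monotone_mult:
  assumes f: "completely_monotone f" and g: "completely_monotone g"
  shows "completely_monotone (\<lambda>z. f z * g z)"
proof -
  let ?F = "\<lambda>k. (deriv ^^ k) f" and ?G = "\<lambda>k. (deriv ^^ k) g"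
  have F: "has_derivs f ?F" and G: "has_derivs g ?G"
    using f g by (simp_all add: completely_monotone_has_derivs)
  have "0 \<le> (- 1) ^ k * (\<Sum>i\<le>k. real (k choose i) * ?F i z * ?G (k - i) z)" if z: "z > 0" for k z
  proof -
    have "(- 1) ^ k * (\<Sum>i\<le>k. real (k choose i) * ?F i z * ?G (k - i) z) =
       (\<Sum>i\<le>k. real (k choose i) * ((- 1) ^ i * ?F i z) * ((- 1) ^ (k - i) * ?G (k - i) z))"
      unfolding sum_distrib_left
    proof (intro sum.cong refl)
      fix i assume "i \<in> {..k}"
      then have "(- 1 :: real) ^ k = (- 1) ^ i * (- 1) ^ (k - i)"
        by (simp flip: power_add)
      then show "(- 1) ^ k * (real (k choose i) * ?F i z * ?G (k - i) z) =
          real (k choose i) * ((- 1) ^ i * ?F i z) * ((- 1) ^ (k - i) * ?G (k - i) z)"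
        by (simp add: ac_simps)
    qed
    also have "\<dots> \<ge> 0"
      by (intro sum_nonneg mult_nonneg_nonneg[OF mult_nonneg_nonneg]
          completely_monotoneD[OF f] completely_monotoneD[OF g] z) auto
    finally show ?thesis .
  qed
  then show ?thesis
    using completely_monotone_iff[OF has_derivs_mult[OF F G]] by simp
qed

lemma completely_monotone_scale:
  assumes "completely_monotone f" "c > 0"
  shows "completely_monotone (\<lambda>z. f (c * z))"
proof -
  have "0 \<le> (- 1) ^ k * (c ^ k * (deriv ^^ k) f (c * z))" if "z > 0" for k z
  proof -
    have "0 \<le> c ^ k * ((- 1) ^ k * (deriv ^^ k) f (c * z))"
      using assms that completely_monotoneD[OF assms(1), of "c * z" k]
      by (intro mult_nonneg_nonneg[of "c ^ k"]) auto
    then show ?thesis by (simp add: ac_simps)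
  qed
  then show ?thesis
    using completely_monotone_iff[OF has_derivs_scale[OF completely_monotone_has_derivs]] assms
    by simp
qed

lemma completely_monotone_power:
  assumes "completely_monotone f"
  shows "completely_monotone (\<lambda>z. f z ^ n)"
proof (induction n)
  case 0
  show ?case
    using completely_monotone_iff[OF has_derivs_const[of 1]] by simp
next
  case (Suc n)
  show ?case using completely_monotone_mult[OF assms Suc] by simp
qed

section \<open>Limits of the derivatives at zero\<close>

text \<open>A one-sided jet: \<open>a\<close> lists the one-sided derivatives of \<open>f\<close> at \<open>0\<close> up to order \<open>m\<close>.
Derivatives of all orders on the open half-line are part of the notion because Leibniz' rule is
applied there, before the limit is taken.\<close>

definition has_jet :: "nat \<Rightarrow> (real \<Rightarrow> real) \<Rightarrow> (nat \<Rightarrow> real) \<Rightarrow> bool" where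
  "has_jet m f a \<longleftrightarrow> (\<exists>F. has_derivs f F \<and> (\<forall>k\<le>m. (F k \<longlongrightarrow> a k) (at_right 0)))"

lemma has_jet_unique:
  assumes "has_jet m f a" "has_jet m f b" "k \<le> m"
  shows "a k = b k"
proof -
  obtain F G where F: "has_derivs f F" "(F k \<longlongrightarrow> a k) (at_right 0)"
    and G: "has_derivs f G" "(G k \<longlongrightarrow> b k) (at_right 0)"
    using assms unfolding has_jet_def by blast
  have "eventually (\<lambda>z. F k z = G k z) (at_right 0)"
    using has_derivs_higher_deriv[OF F(1)] has_derivs_higher_deriv[OF G(1)]
    by (auto simp: eventually_at_filter)
  with F(2) have "(G k \<longlongrightarrow> a k) (at_right 0)"
    by (simp add: tendsto_cong)
  with G(2) show ?thesis
    by (intro tendsto_unique[OF _ _ G(2)]) auto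
qed

lemma has_jet_higher_deriv:
  assumes "has_jet m f a" "k \<le> m"
  shows "((deriv ^^ k) f \<longlongrightarrow> a k) (at_right 0)"
proof -
  obtain F where F: "has_derivs f F" "(F k \<longlongrightarrow> a k) (at_right 0)"
    using assms unfolding has_jet_def by blast
  have "eventually (\<lambda>z. (deriv ^^ k) f z = F k z) (at_right 0)"
    using has_derivs_higher_deriv[OF F(1)] by (auto simp: eventually_at_filter)
  with F(2) show ?thesis
    by (simp add: tendsto_cong)
qed

lemma has_jet_cong: "has_jet m f a \<Longrightarrow> (\<And>k. k \<le> m \<Longrightarrow> a k = b k) \<Longrightarrow> has_jet m f b"
  unfolding has_jet_def by metis

lemma has_jet_mult:
  assumes f: "has_jet m f a" and g: "has_jet m g b"
  shows "has_jet m (\<lambda>z. f z * g z) (\<lambda>k. \<Sum>i\<le>k. real (k choose i) * a i * b (k - i))"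
proof -
  obtain F G where F: "has_derivs f F" "\<And>k. k \<le> m \<Longrightarrow> (F k \<longlongrightarrow> a k) (at_right 0)"
    and G: "has_derivs g G" "\<And>k. k \<le> m \<Longrightarrow> (G k \<longlongrightarrow> b k) (at_right 0)"
    using f g unfolding has_jet_def by blast
  have "((\<lambda>z. \<Sum>i\<le>k. real (k choose i) * F i z * G (k - i) z) \<longlongrightarrow>
      (\<Sum>i\<le>k. real (k choose i) * a i * b (k - i))) (at_right 0)" if "k \<le> m" for k
    using that by (intro tendsto_intros F(2) G(2)) auto
  then show ?thesis
    using has_derivs_mult[OF F(1) G(1)] unfolding has_jet_def by blast
qed

lemma has_jet_scale:
  assumes f: "has_jet m f a" and c: "c > 0"
  shows "has_jet m (\<lambda>z. f (c * z)) (\<lambda>k. c ^ k * a k)"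
proof -
  obtain F where F: "has_derivs f F" "\<And>k. k \<le> m \<Longrightarrow> (F k \<longlongrightarrow> a k) (at_right 0)"
    using f unfolding has_jet_def by blast
  have "filterlim (\<lambda>z. c * z) (at_right 0) (at_right (0::real))"
    by (rule filterlim_times_pos[OF filterlim_ident c]) simp
  then have "((\<lambda>z. c ^ k * F k (c * z)) \<longlongrightarrow> c ^ k * a k) (at_right 0)" if "k \<le> m" for k
    using that by (intro tendsto_mult_left filterlim_compose[OF F(2)])
  then show ?thesis
    using has_derivs_scale[OF F(1) c] unfolding has_jet_def by blast
qed

lemma has_jet_exp: "has_jet m (\<lambda>z. exp (t * z)) (\<lambda>k. t ^ k)"
proof -
  have "((\<lambda>z. t ^ k * exp (t * z)) \<longlongrightarrow> t ^ k * exp (t * 0)) (at_right 0)" for k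
    by (intro tendsto_intros)
  then show ?thesis
    using has_derivs_exp[of t] unfolding has_jet_def by auto
qed

lemma has_jet_one: "has_jet m (\<lambda>z. 1) (\<lambda>k. if k = 0 then 1 else 0)"
proof -
  have "((\<lambda>z. if k = 0 then 1 else 0) \<longlongrightarrow> (if k = 0 then 1 else 0 :: real)) (at_right (0::real))"
    for k :: nat
    by (rule tendsto_const)
  then show ?thesis
    using has_derivs_const[of 1] unfolding has_jet_def by blast
qed

lemma binomial_sums_up_to_4:
  fixes a b :: "nat \<Rightarrow> real"
  shows "(\<Sum>i\<le>0. real (0 choose i) * a i * b (0 - i)) = a 0 * b 0"
    "(\<Sum>i\<le>1. real (1 choose i) * a i * b (1 - i)) = a 0 * b 1 + a 1 * b 0"
    "(\<Sum>i\<le>2. real (2 choose i) * a i * b (2 - i)) = a 0 * b 2 + 2 * a 1 * b 1 + a 2 * b 0"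
    "(\<Sum>i\<le>3. real (3 choose i) * a i * b (3 - i)) =
       a 0 * b 3 + 3 * a 1 * b 2 + 3 * a 2 * b 1 + a 3 * b 0"
    "(\<Sum>i\<le>4. real (4 choose i) * a i * b (4 - i)) =
       a 0 * b 4 + 4 * a 1 * b 3 + 6 * a 2 * b 2 + 4 * a 3 * b 1 + a 4 * b 0"
  by (simp_all add: eval_nat_numeral)

lemma le_4_cases:
  fixes k :: nat
  assumes "k \<le> 4"
  obtains "k = 0" | "k = 1" | "k = 2" | "k = 3" | "k = 4"
  using assms by linarith

text \<open>Read with \<open>f\<close> as the transform of a centered random variable, these are, up to sign, the central
moments of a sum of \<open>n\<close> independent copies: up to order three they add up, and in order four each of the \<open>n(n - 1)/2\<close> pairs
of summands contributes \<open>6\<close> times the product of their variances.\<close>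

lemma has_jet_power:
  assumes f: "has_jet 4 f a" and a: "a 0 = 1" "a 1 = 0"
  shows "has_jet 4 (\<lambda>z. f z ^ n)
    (\<lambda>k. if k = 0 then 1
         else real n * a k + (if k = 4 then 3 * real n * (real n - 1) * (a 2)\<^sup>2 else 0))"
proof (induction n)
  case 0
  show ?case
    by (rule has_jet_cong[of 4 _ "\<lambda>k. if k = 0 then 1 else 0"]) (use has_jet_one in auto)
next
  case (Suc n)
  define b where "b = (\<lambda>k. if k = 0 then 1
         else real n * a k + (if k = 4 then 3 * real n * (real n - 1) * (a 2)\<^sup>2 else 0))"
  have b: "b 0 = 1" "b 1 = 0" "b 2 = n * a 2" "b 3 = n * a 3"
    "b 4 = n * a 4 + 3 * real n * (real n - 1) * (a 2)\<^sup>2"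
    using a by (simp_all add: b_def)
  have eq: "(\<Sum>i\<le>k. real (k choose i) * a i * b (k - i)) = (if k = 0 then 1 else
      real (Suc n) * a k + (if k = 4 then 3 * real (Suc n) * (real (Suc n) - 1) * (a 2)\<^sup>2 else 0))"
    if "k \<le> 4" for k
  proof (rule le_4_cases[OF that])
    assume k: "k = 0"
    show ?thesis unfolding k binomial_sums_up_to_4 by (simp add: a b)
  next
    assume k: "k = 1"
    show ?thesis unfolding k binomial_sums_up_to_4 a b by simp
  next
    assume k: "k = 2"
    show ?thesis unfolding k binomial_sums_up_to_4 a b by (simp add: distrib_right)
  next
    assume k: "k = 3"
    show ?thesis unfolding k binomial_sums_up_to_4 a b by (simp add: distrib_right)
  next
    assume k: "k = 4"
    show ?thesis unfolding k binomial_sums_up_to_4 a b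
      by (simp add: algebra_simps power2_eq_square)
  qed
  have "has_jet 4 (\<lambda>z. f z * f z ^ n) (\<lambda>k. \<Sum>i\<le>k. real (k choose i) * a i * b (k - i))"
    using has_jet_mult[OF f Suc] unfolding b_def .
  then show ?case
    by (subst power_Suc) (rule has_jet_cong[OF _ eq])
qed

section \<open>Derivatives and moments of a Laplace transform\<close>

lemma power_exp_bound:
  fixes s c :: real assumes "s \<ge> 0" "c > 0"
  shows "s ^ k * exp (- (c * s)) \<le> fact k / c ^ k"
proof -
  have "(c * s) ^ k / fact k \<le> exp (c * s)"
    using sum_le_suminf[of "\<lambda>n. (c * s) ^ n /\<^sub>R fact n" "{k}"] assms summable_exp_generic[of "c * s"]
    by (auto simp: exp_def field_simps)
  then show ?thesis
    using assms by (simp add: exp_minus power_mult_distrib field_simps)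
qed

text \<open>The mean value inequality for the exponential; it dominates the difference quotients of a Laplace
transform.\<close>

lemma exp_diff_bound:
  fixes a b m :: real assumes "m \<le> a" "m \<le> b"
  shows "\<bar>exp (- a) - exp (- b)\<bar> \<le> \<bar>a - b\<bar> * exp (- m)"
proof -
  have *: "exp (- x) - exp (- y) \<le> (y - x) * exp (- m)" if "m \<le> x" "x \<le> y" for x y
  proof -
    have "exp (- x) - exp (- y) = exp (- x) * (1 - exp (x - y))"
      by (simp add: algebra_simps flip: exp_add)
    also have "\<dots> \<le> exp (- x) * (y - x)"
      using exp_ge_add_one_self[of "x - y"] by (intro mult_left_mono) (auto simp: algebra_simps)
    also have "\<dots> \<le> exp (- m) * (y - x)"
      using that by (intro mult_right_mono) auto
    finally show ?thesis by (simp add: mult.commute)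
  qed
  show ?thesis
    using *[of a b] *[of b a] assms by (cases "a \<le> b") (auto simp: abs_if)
qed

lemma represents_space: "represents \<nu> g \<Longrightarrow> space \<nu> = {0..}"
  using sets_eq_imp_space_eq[of \<nu> "restrict_space borel {0..}"]
  by (simp add: represents_def space_restrict_space)

lemma represents_measurable:
  "represents \<nu> g \<Longrightarrow> continuous_on {0..} f \<Longrightarrow> f \<in> borel_measurable \<nu>"
  using borel_measurable_continuous_on_restrict[of "{0..}" f]
  by (simp add: represents_def cong: measurable_cong_sets)

lemma represents_measurable_ident: "represents \<nu> g \<Longrightarrow> (\<lambda>s. s) \<in> borel_measurable \<nu>"
  by (rule represents_measurable) (auto intro: continuous_intros)

lemma represents_integrable_power_exp:
  assumes rep: "represents \<nu> g" and z: "z > 0"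
  shows "integrable \<nu> (\<lambda>s. s ^ k * exp (- (z * s)))"
proof (rule Bochner_Integration.integrable_bound)
  note [measurable] = represents_measurable_ident[OF rep]
  show "integrable \<nu> (\<lambda>s. fact k / (z / 2) ^ k * exp (- (z / 2 * s)))"
    using rep z by (intro integrable_mult_right)
      (auto simp: represents_def has_bochner_integral_iff dest!: spec[of _ "z / 2"])
  show "(\<lambda>s. s ^ k * exp (- (z * s))) \<in> borel_measurable \<nu>"
    by measurable
  show "AE s in \<nu>. norm (s ^ k * exp (- (z * s))) \<le> norm (fact k / (z / 2) ^ k * exp (- (z / 2 * s)))"
  proof (rule AE_I2)
    fix s assume "s \<in> space \<nu>"
    then have s: "s \<ge> 0" using represents_space[OF rep] by simp
    have "s ^ k * exp (- (z * s)) = (s ^ k * exp (- (z / 2 * s))) * exp (- (z / 2 * s))"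
      by (simp flip: exp_add)
    also have "\<dots> \<le> fact k / (z / 2) ^ k * exp (- (z / 2 * s))"
      using power_exp_bound[OF s, of "z / 2" k] z by (intro mult_right_mono) auto
    finally show "norm (s ^ k * exp (- (z * s))) \<le> norm (fact k / (z / 2) ^ k * exp (- (z / 2 * s)))"
      using s z by simp
  qed
qed

lemma power_minus_mult:
  fixes s e :: real
  shows "(- s) ^ k * e = (- 1) ^ k * (s ^ k * e)"
  by (subst power_minus) (simp add: mult.assoc)

text \<open>Differentiation under the integral sign. Since half of the exponential decay already absorbs every
power of \<open>s\<close>, all difference quotients at \<open>z\<close> with argument above \<open>z/2\<close> have the common integrable
majorant \<open>s\<^sup>k\<^sup>+\<^sup>1 e\<^sup>-\<^sup>z\<^sup>s\<^sup>/\<^sup>2\<close>.\<close>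

lemma represents_has_derivs:
  assumes rep: "represents \<nu> g"
  shows "has_derivs g (\<lambda>k z. \<integral>s. (- s) ^ k * exp (- (z * s)) \<partial>\<nu>)"
  unfolding has_derivs_def
proof (intro conjI allI impI)
  fix z :: real assume "z > 0"
  then have "has_bochner_integral \<nu> (\<lambda>s. exp (- (z * s))) (g z)"
    using rep unfolding represents_def by blast
  then show "(\<integral>s. (- s) ^ 0 * exp (- (z * s)) \<partial>\<nu>) = g z"
    by (simp add: has_bochner_integral_integral_eq)
next
  fix k and z :: real assume z: "z > 0"
  note [measurable] = represents_measurable_ident[OF rep]
  let ?f = "\<lambda>k z s. (- s) ^ k * exp (- (z * s))"
  let ?S = "{z / 2<..}"
  have int: "integrable \<nu> (?f k z)" if "z > 0" for k z
    by (subst power_minus_mult)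
      (intro integrable_mult_right represents_integrable_power_exp[OF rep that])
  \<comment> \<open>Taking the limit within the half-line above \<open>z/2\<close> lets the majorant hold for every
    term of a sequence approaching \<open>z\<close>, not only eventually.\<close>
  have "((\<lambda>w. ((\<integral>s. ?f k w s \<partial>\<nu>) - (\<integral>s. ?f k z s \<partial>\<nu>)) / (w - z)) \<longlongrightarrow> (\<integral>s. ?f (Suc k) z s \<partial>\<nu>))
    (at z within ?S)"
    unfolding tendsto_at_iff_sequentially comp_def
  proof (intro allI impI)
    fix X :: "nat \<Rightarrow> real" assume X: "\<forall>i. X i \<in> ?S - {z}" "X \<longlonglongrightarrow> z"
    have Xi: "X i > z / 2" "X i \<noteq> z" "X i > 0" for i
      using X(1) z by (auto dest!: spec[of _ i])
    have "(\<lambda>i. \<integral>s. (?f k (X i) s - ?f k z s) / (X i - z) \<partial>\<nu>) \<longlonglongrightarrow> (\<integral>s. ?f (Suc k) z s \<partial>\<nu>)"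
    proof (rule integral_dominated_convergence[where w="\<lambda>s. s ^ Suc k * exp (- (z / 2 * s))"])
      show "integrable \<nu> (\<lambda>s. s ^ Suc k * exp (- (z / 2 * s)))"
        using z by (intro represents_integrable_power_exp[OF rep]) auto
      show "AE s in \<nu>. (\<lambda>i. (?f k (X i) s - ?f k z s) / (X i - z)) \<longlonglongrightarrow> ?f (Suc k) z s"
      proof (rule AE_I2)
        fix s
        have "((\<lambda>w. ?f k w s) has_real_derivative ?f (Suc k) z s) (at z within ?S)"
          by (auto intro!: derivative_eq_intros)
        then show "(\<lambda>i. (?f k (X i) s - ?f k z s) / (X i - z)) \<longlonglongrightarrow> ?f (Suc k) z s"
          unfolding has_field_derivative_iff tendsto_at_iff_sequentially comp_def using X by blast
      qed
      show "AE s in \<nu>. norm ((?f k (X i) s - ?f k z s) / (X i - z)) \<le> s ^ Suc k * exp (- (z / 2 * s))"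
        for i
      proof (rule AE_I2)
        fix s assume "s \<in> space \<nu>"
        then have s: "s \<ge> 0" using represents_space[OF rep] by simp
        have "norm (?f k (X i) s - ?f k z s) = s ^ k * \<bar>exp (- (X i * s)) - exp (- (z * s))\<bar>"
          using s by (simp add: abs_mult power_abs flip: right_diff_distrib)
        also have "\<dots> \<le> s ^ k * (\<bar>X i * s - z * s\<bar> * exp (- (z / 2 * s)))"
          using s Xi[of i] z by (intro mult_left_mono exp_diff_bound mult_right_mono) auto
        also have "\<bar>X i * s - z * s\<bar> = \<bar>X i - z\<bar> * s"
          using s by (simp add: abs_mult flip: left_diff_distrib)
        finally have "norm (?f k (X i) s - ?f k z s) \<le> s ^ Suc k * exp (- (z / 2 * s)) * \<bar>X i - z\<bar>"
          by (simp add: ac_simps)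
        then show "norm ((?f k (X i) s - ?f k z s) / (X i - z)) \<le> s ^ Suc k * exp (- (z / 2 * s))"
          using Xi[of i] by (simp add: norm_divide pos_divide_le_eq)
      qed
    qed measurable
    also have "(\<lambda>i. \<integral>s. (?f k (X i) s - ?f k z s) / (X i - z) \<partial>\<nu>) =
      (\<lambda>i. ((\<integral>s. ?f k (X i) s \<partial>\<nu>) - (\<integral>s. ?f k z s \<partial>\<nu>)) / (X i - z))"
      using int[OF Xi(3)] int[OF z] by simp
    finally show "(\<lambda>i. ((\<integral>s. ?f k (X i) s \<partial>\<nu>) - (\<integral>s. ?f k z s \<partial>\<nu>)) / (X i - z))
      \<longlonglongrightarrow> (\<integral>s. ?f (Suc k) z s \<partial>\<nu>)" .
  qed
  then show "((\<lambda>z. \<integral>s. ?f k z s \<partial>\<nu>) has_real_derivative (\<integral>s. ?f (Suc k) z s \<partial>\<nu>)) (at z)"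
    using at_within_open[of z ?S] z by (simp add: has_field_derivative_iff)
qed

text \<open>As \<open>z\<close> decreases to \<open>0\<close>, the integrands \<open>s\<^sup>k e\<^sup>-\<^sup>z\<^sup>s\<close> increase to \<open>s\<^sup>k\<close>. By monotone convergence a finite limit
of the derivatives forces the moment to be finite.\<close>

lemma represents_moments:
  assumes rep: "represents \<nu> g" and jet: "has_jet m g a" and k: "k \<le> m"
  shows "has_bochner_integral \<nu> (\<lambda>s. s ^ k) ((- 1) ^ k * a k)"
proof -
  note [measurable] = represents_measurable_ident[OF rep]
  define Z where "Z i = 1 / real (Suc i)" for i
  have Z: "Z i > 0" for i by (simp add: Z_def)
  have Z0: "Z \<longlonglongrightarrow> 0"
    unfolding Z_def by (rule LIMSEQ_Suc) (rule lim_1_over_n)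
  have dec: "Z j \<le> Z i" if "i \<le> j" for i j
    using that by (simp add: Z_def field_simps)
  have "filterlim Z (at_right 0) sequentially"
    unfolding filterlim_at using Z Z0 by (auto simp: less_imp_neq[symmetric])
  from filterlim_compose[OF has_jet_higher_deriv[OF jet k] this]
  have "(\<lambda>i. (- 1) ^ k * (deriv ^^ k) g (Z i)) \<longlonglongrightarrow> (- 1) ^ k * a k"
    by (intro tendsto_mult_left)
  moreover have "(- 1) ^ k * (deriv ^^ k) g (Z i) = (\<integral>s. s ^ k * exp (- (Z i * s)) \<partial>\<nu>)" for i
    unfolding has_derivs_higher_deriv[OF represents_has_derivs[OF rep] Z]
  proof -
    have "(\<integral>s. (- s) ^ k * exp (- (Z i * s)) \<partial>\<nu>) = (\<integral>s. (- 1) ^ k * (s ^ k * exp (- (Z i * s))) \<partial>\<nu>)"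
      by (subst power_minus_mult) (rule refl)
    also have "\<dots> = (- 1) ^ k * (\<integral>s. s ^ k * exp (- (Z i * s)) \<partial>\<nu>)"
      by (rule integral_mult_right_zero)
    finally show "(- 1) ^ k * (\<integral>s. (- s) ^ k * exp (- (Z i * s)) \<partial>\<nu>) =
        (\<integral>s. s ^ k * exp (- (Z i * s)) \<partial>\<nu>)"
      by (simp add: mult.assoc[symmetric] flip: power_mult_distrib)
  qed
  ultimately have lim: "(\<lambda>i. \<integral>s. s ^ k * exp (- (Z i * s)) \<partial>\<nu>) \<longlonglongrightarrow> (- 1) ^ k * a k"
    by simp
  have 1: "integrable \<nu> (\<lambda>s. s ^ k * exp (- (Z i * s)))" for i
    using Z by (rule represents_integrable_power_exp[OF rep])
  have 2: "AE s in \<nu>. mono (\<lambda>i. s ^ k * exp (- (Z i * s)))"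
    using represents_space[OF rep]
    by (intro AE_I2 monoI mult_left_mono) (auto intro!: mult_right_mono dec)
  have "(\<lambda>i. s ^ k * exp (- (Z i * s))) \<longlonglongrightarrow> s ^ k * exp (- (0 * s))" for s
    by (intro tendsto_intros Z0)
  then have 3: "AE s in \<nu>. (\<lambda>i. s ^ k * exp (- (Z i * s))) \<longlonglongrightarrow> s ^ k"
    by simp
  show ?thesis
    unfolding has_bochner_integral_iff
    using integrable_monotone_convergence[OF 1 2 3 lim] integral_monotone_convergence[OF 1 2 3 lim]
    by simp
qed

text \<open>Multiplying the transform by \<open>e\<^sup>t\<^sup>z\<close> shifts the measure by \<open>-t\<close>. On the level of moments both operations
are the same binomial convolution with the powers of \<open>t\<close>.\<close>

lemma represents_central_moments:
  assumes rep: "represents \<nu> g" and jet: "has_jet m g a" and k: "k \<le> m"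
    and ejet: "has_jet m (\<lambda>z. exp (t * z) * g z) c"
  shows "has_bochner_integral \<nu> (\<lambda>s. (s - t) ^ k) ((- 1) ^ k * c k)"
proof -
  have "has_bochner_integral \<nu>
      (\<lambda>s. \<Sum>i\<le>k. (- 1) ^ k * (real (k choose i) * t ^ i * (- 1) ^ (k - i)) * s ^ (k - i))
      (\<Sum>i\<le>k. (- 1) ^ k * (real (k choose i) * t ^ i * (- 1) ^ (k - i)) * ((- 1) ^ (k - i) * a (k - i)))"
    using k by (intro has_bochner_integral_sum has_bochner_integral_mult_right
        represents_moments[OF rep jet]) auto
  moreover have "(\<Sum>i\<le>k. (- 1) ^ k * (real (k choose i) * t ^ i * (- 1) ^ (k - i)) * s ^ (k - i)) =
      (s - t) ^ k" for s
  proof -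
    have "(s - t) ^ k = (- 1) ^ k * (t + - s) ^ k"
      by (simp flip: power_mult_distrib)
    also have "\<dots> = (\<Sum>i\<le>k. (- 1) ^ k * (real (k choose i) * t ^ i * (- s) ^ (k - i)))"
      by (simp only: binomial_ring sum_distrib_left of_nat_id)
    also have "\<dots> = (\<Sum>i\<le>k. (- 1) ^ k * (real (k choose i) * t ^ i * (- 1) ^ (k - i)) * s ^ (k - i))"
      by (intro sum.cong refl) (subst power_minus, simp add: mult.assoc)
    finally show ?thesis by simp
  qed
  moreover have "(\<Sum>i\<le>k. (- 1) ^ k * (real (k choose i) * t ^ i * (- 1) ^ (k - i)) * ((- 1) ^ (k - i) * a (k - i)))
      = (- 1) ^ k * c k"
  proof -
    have "c k = (\<Sum>i\<le>k. real (k choose i) * t ^ i * a (k - i))"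
      using has_jet_unique[OF ejet has_jet_mult[OF has_jet_exp jet] k] .
    moreover have "(- 1) ^ j * ((- 1) ^ j * x) = x" for j and x :: real
      by (simp flip: power_mult_distrib mult.assoc)
    ultimately show ?thesis
      by (simp add: sum_distrib_left mult.assoc)
  qed
  ultimately show ?thesis by simp
qed

section \<open>Bernstein's theorem\<close>

text \<open>All terms and remainders to the left of \<open>b\<close> are nonnegative, so the remainder at a second point \<open>w\<close>
with \<open>y < w < b\<close> is at most \<open>h(b - w)\<close>. In the integral form of the remainder, \<open>y - v \<le> (y/w)(w - v)\<close> shows
that the remainder of order \<open>p + 1\<close> at \<open>y\<close> is at most \<open>(y/w)\<^sup>p\<close> times the one at \<open>w\<close>, hence it tends to \<open>0\<close>.
With Lagrange's form the same comparison would reach only \<open>y < b/2\<close>, whereas \<open>b - y\<close> has to come close to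
\<open>0\<close> for the total mass and the transforms below.\<close>

lemma completely_monotone_taylor_sums:
  assumes cm: "completely_monotone h" and y: "0 \<le> y" "y < b"
  shows "(\<lambda>k. (- 1) ^ k * (deriv ^^ k) h b / fact k * y ^ k) sums h (b - y)"
proof -
  define D where "D k v = (- 1) ^ k * (deriv ^^ k) h (b - v)" for k v
  define R where "R p y = integral {0..y} (\<lambda>v. ((y - v) ^ (p - 1) / fact (p - 1)) *\<^sub>R D p v)" for p y
  note hd = completely_monotone_has_derivs[OF cm]
  have D_nonneg: "D k v \<ge> 0" if "v < b" for k v
    using completely_monotoneD[OF cm, of "b - v" k] that by (simp add: D_def)
  have D_deriv: "(D m has_vector_derivative D (Suc m) t) (at t within {0..y})" if "t < b" for m t y
  proof -
    have "((deriv ^^ m) h has_real_derivative (deriv ^^ Suc m) h (b - t)) (at (b - t))"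
      using has_derivs_Suc[OF hd, of "b - t" m] that by simp
    then have "((\<lambda>t. (deriv ^^ m) h (b - t)) has_real_derivative (deriv ^^ Suc m) h (b - t) * (- 1))
      (at t within {0..y})"
      by (rule DERIV_chain2) (auto intro!: derivative_eq_intros)
    from DERIV_cmult[OF this, of "(- 1) ^ m"] show ?thesis
      unfolding has_real_derivative_iff_has_vector_derivative[symmetric] D_def by simp
  qed
  have taylor: "h (b - y) = (\<Sum>i<p. y ^ i / fact i * D i 0) + R p y"
    and integrable: "(\<lambda>v. ((y - v) ^ (p - 1) / fact (p - 1)) *\<^sub>R D p v) integrable_on {0..y}"
    if "p > 0" "0 \<le> y" "y < b" for p y
    using Taylor_integral[of p D "D 0" 0 y] Taylor_integrable[of p D "D 0" 0 y] that D_deriv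
    by (simp_all add: R_def D_def)
  have R_le: "R p y \<le> h (b - y)" if "p > 0" "0 \<le> y" "y < b" for p y
    unfolding taylor[OF that] using that D_nonneg
    by (auto intro!: sum_nonneg mult_nonneg_nonneg)
  have R_nonneg: "R p y \<ge> 0" if "p > 0" "0 \<le> y" "y < b" for p y
    unfolding R_def using that D_nonneg
    by (intro integral_nonneg integrable that) (auto intro!: mult_nonneg_nonneg)
  define w where "w = (y + b) / 2"
  have w: "y < w" "w < b" "0 < w" "0 \<le> w" using y by (auto simp: w_def)
  have R_bound: "R (Suc p) y \<le> (y / w) ^ p * h (b - w)" for p
  proof -
    let ?i = "\<lambda>y v. ((y - v) ^ (Suc p - 1) / fact (Suc p - 1)) *\<^sub>R D (Suc p) v"
    have int: "?i w integrable_on {0..w}" "?i y integrable_on {0..y}"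
      by (rule integrable; use w y in simp)+
    then have int': "?i w integrable_on {0..y}"
      using w by (auto intro: integrable_on_subinterval)
    have "R (Suc p) y \<le> integral {0..y} (\<lambda>v. (y / w) ^ p * ?i w v)"
      unfolding R_def
    proof (rule integral_le[OF int(2)])
      show "(\<lambda>v. (y / w) ^ p * ?i w v) integrable_on {0..y}"
        using int' by (rule integrable_on_mult_right)
      fix v assume v: "v \<in> {0..y}"
      have "v * y \<le> v * w" using v w by (intro mult_left_mono) auto
      then have "y - v \<le> y / w * (w - v)"
        using w by (simp add: field_simps)
      then have "(y - v) ^ p \<le> (y / w * (w - v)) ^ p"
        using v by (intro power_mono) auto
      then have "(y - v) ^ p / fact p * D (Suc p) v \<le> (y / w * (w - v)) ^ p / fact p * D (Suc p) v"
        using D_nonneg[of v "Suc p"] v y by (intro mult_right_mono divide_right_mono) auto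
      then show "?i y v \<le> (y / w) ^ p * ?i w v"
        by (simp only: power_mult_distrib diff_Suc_1 real_scaleR_def times_divide_eq_right mult.assoc)
          (simp add: mult.assoc)
    qed
    also have "\<dots> = (y / w) ^ p * integral {0..y} (?i w)"
      by (rule integral_mult_right)
    also have "integral {0..y} (?i w) \<le> R (Suc p) w"
      unfolding R_def
    proof (rule integral_subset_le[OF _ int' int(1)])
      show "\<forall>v\<in>{0..w}. 0 \<le> ?i w v"
        using D_nonneg w by (auto intro!: mult_nonneg_nonneg)
    qed (use w in auto)
    also have "R (Suc p) w \<le> h (b - w)"
      using w by (intro R_le) auto
    finally show ?thesis
      using y w by (simp add: mult_left_mono)
  qed
  have lim: "(\<lambda>p. (y / w) ^ p * h (b - w)) \<longlonglongrightarrow> 0"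
    using y w by (intro tendsto_mult_left_zero LIMSEQ_power_zero) auto
  have "(\<lambda>p. R (Suc p) y) \<longlonglongrightarrow> 0"
  proof (rule tendsto_sandwich[OF _ _ tendsto_const lim])
    show "\<forall>\<^sub>F p in sequentially. 0 \<le> R (Suc p) y"
      using R_nonneg y by simp
    show "\<forall>\<^sub>F p in sequentially. R (Suc p) y \<le> (y / w) ^ p * h (b - w)"
      using R_bound by simp
  qed
  then have "(\<lambda>p. h (b - y) - R (Suc p) y) \<longlonglongrightarrow> h (b - y) - 0"
    by (intro tendsto_intros)
  moreover have "h (b - y) - R (Suc p) y = (\<Sum>i<Suc p. y ^ i / fact i * D i 0)" for p
    using taylor[of "Suc p" y] y by simp
  ultimately have "(\<lambda>p. \<Sum>i<Suc p. y ^ i / fact i * D i 0) \<longlonglongrightarrow> h (b - y)"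
    by simp
  then have "(\<lambda>p. \<Sum>i<p. y ^ i / fact i * D i 0) \<longlonglongrightarrow> h (b - y)"
    by (rule LIMSEQ_imp_Suc)
  then show ?thesis
    unfolding sums_def by (simp add: D_def ac_simps)
qed

lemma completely_monotone_antimono:
  assumes cm: "completely_monotone h" and "0 < x" "x \<le> y"
  shows "(- 1) ^ k * (deriv ^^ k) h y \<le> (- 1) ^ k * (deriv ^^ k) h x"
proof (rule DERIV_nonpos_imp_nonincreasing[OF assms(3)])
  fix z assume "x \<le> z" "z \<le> y"
  then have z: "z > 0" using assms by simp
  have "((\<lambda>z. (- 1) ^ k * (deriv ^^ k) h z) has_real_derivative (- 1) ^ k * (deriv ^^ Suc k) h z) (at z)"
    by (intro DERIV_cmult has_derivs_Suc[OF completely_monotone_has_derivs[OF cm] z])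
  then show "\<exists>y. ((\<lambda>z. (- 1) ^ k * (deriv ^^ k) h z) has_real_derivative y) (at z) \<and> y \<le> 0"
    using completely_monotoneD[OF cm z, of "Suc k"] by auto
qed

text \<open>The weights are the terms of the Taylor series about \<open>b\<close>, evaluated at distance \<open>b\<close>, that is at the
point \<open>0\<close>. Their sum is \<open>h(0+) = 1\<close>, by letting \<open>r\<close> increase to \<open>1\<close>; the terms being nonnegative, this
limit may be taken term by term.\<close>

lemma completely_monotone_sampling_pmf:
  assumes cm: "completely_monotone h" and h1: "(h \<longlongrightarrow> 1) (at_right 0)" and b: "b > 0"
  obtains p :: "nat pmf" where
    "\<And>r. 0 < r \<Longrightarrow> r < 1 \<Longrightarrow> (\<lambda>k. pmf p k * r ^ k) sums h (b - b * r)"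
proof -
  define a where "a k = (- 1) ^ k * (deriv ^^ k) h b / fact k * b ^ k" for k
  have a_nonneg: "a k \<ge> 0" for k
    using completely_monotoneD[OF cm b, of k] b by (simp add: a_def)
  have a_sums: "(\<lambda>k. a k * r ^ k) sums h (b - b * r)" if "0 < r" "r < 1" for r
    using completely_monotone_taylor_sums[OF cm, of "b * r" b] that b
    by (simp add: a_def power_mult_distrib mult.assoc)
  have sum_le: "sum a {..<K} \<le> 1" for K
  proof -
    have "((\<lambda>z. \<Sum>k<K. a k * (1 - z / b) ^ k) \<longlongrightarrow> (\<Sum>k<K. a k * (1 - 0 / b) ^ k)) (at_right 0)"
      using b by (intro tendsto_intros) auto
    moreover have "\<forall>\<^sub>F z in at_right 0. (\<Sum>k<K. a k * (1 - z / b) ^ k) \<le> h z"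
    proof -
      have "(\<Sum>k<K. a k * (1 - z / b) ^ k) \<le> h z" if "0 < z" "z < b" for z
        using sum_le_suminf[of "\<lambda>k. a k * (1 - z / b) ^ k" "{..<K}"] a_sums[of "1 - z / b"] that a_nonneg
        by (auto simp: sums_iff field_simps)
      then show ?thesis
        using b by (auto simp: eventually_at_right_field)
    qed
    ultimately show ?thesis
      using tendsto_le[OF _ h1] by fastforce
  qed
  have summable: "summable a"
  proof (rule bounded_imp_summable[OF a_nonneg])
    show "sum a {..n} \<le> 1" for n
      using sum_le[of "Suc n"] by (simp only: lessThan_Suc_atMost)
  qed
  have "suminf a = 1"
  proof (rule antisym)
    show "suminf a \<le> 1"
      using summable sum_le by (rule suminf_le_const)
    have "h z \<le> suminf a" if "0 < z" "z < b" for z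
    proof -
      have "a k * (1 - z / b) ^ k \<le> a k * 1" for k
        using that b a_nonneg by (intro mult_left_mono power_le_one) auto
      then have "(\<Sum>k. a k * (1 - z / b) ^ k) \<le> suminf a"
        using a_sums[of "1 - z / b"] summable that by (intro suminf_le) (auto simp: sums_iff field_simps)
      then show ?thesis
        using a_sums[of "1 - z / b"] that by (auto simp: sums_iff field_simps)
    qed
    then have "\<forall>\<^sub>F z in at_right 0. h z \<le> suminf a"
      using b by (auto simp: eventually_at_right_field)
    then show "1 \<le> suminf a"
      by (intro tendsto_upperbound[OF h1]) auto
  qed
  then have "(\<integral>\<^sup>+k. ennreal (a k) \<partial>count_space UNIV) = 1"
    using suminf_ennreal2[OF a_nonneg summable] by (simp add: nn_integral_count_space_nat)
  then have "pmf (embed_pmf a) = a"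
    using pmf_embed_pmf[of a, OF a_nonneg] by (intro ext) auto
  then show ?thesis
    using that[of "embed_pmf a"] a_sums by simp
qed

lemma integral_nat_pmf:
  fixes p :: "nat pmf" and f :: "nat \<Rightarrow> real"
  assumes "(\<lambda>k. pmf p k * f k) sums c" "\<And>k. f k \<ge> 0"
  shows "(\<integral>k. f k \<partial>measure_pmf p) = c"
proof -
  have "(\<integral>k. f k \<partial>measure_pmf p) = (\<integral>k. pmf p k *\<^sub>R f k \<partial>count_space UNIV)"
    unfolding measure_pmf_eq_density by (subst integral_density) auto
  also have "\<dots> = (\<Sum>k. pmf p k * f k)"
    using assms by (subst integral_count_space_nat) (auto simp: integrable_count_space_nat_iff sums_iff)
  finally show ?thesis
    using assms by (simp add: sums_iff)
qed

text \<open>The points at which \<open>h\<close> is evaluated by the transforms of the discrete measures below.\<close>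

lemma Bernstein_sampling_limit:
  fixes z :: real assumes "z \<ge> 0"
  shows "(\<lambda>i. real (Suc i) - real (Suc i) * exp (- (z / real (Suc i)))) \<longlonglongrightarrow> z"
    and "real (Suc i) - real (Suc i) * exp (- (z / real (Suc i))) \<le> z"
proof -
  have up: "real (Suc i) - real (Suc i) * exp (- (z / real (Suc i))) \<le> z" for i
  proof -
    have "real (Suc i) * (1 - z / real (Suc i)) \<le> real (Suc i) * exp (- (z / real (Suc i)))"
      using exp_ge_add_one_self[of "- (z / real (Suc i))"] by (intro mult_left_mono) auto
    then show ?thesis by (simp add: right_diff_distrib)
  qed
  have low: "z / (1 + z * (1 / real (Suc i))) \<le> real (Suc i) - real (Suc i) * exp (- (z / real (Suc i)))" for i
  proof -
    define b where "b = real (Suc i)"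
    have b: "b > 0" by (simp add: b_def)
    have pos: "1 + z / b > 0" using assms b by (simp add: add_pos_nonneg)
    have "exp (- (z / b)) \<le> 1 / (1 + z / b)"
      using exp_ge_add_one_self[of "z / b"] pos by (simp add: exp_minus field_simps)
    then have "b * exp (- (z / b)) \<le> b * (1 / (1 + z / b))"
      using b by (intro mult_left_mono) auto
    moreover have "b - b * (1 / (1 + z / b)) = z / (1 + z * (1 / b))"
      using b pos by (simp add: field_simps)
    ultimately show ?thesis unfolding b_def[symmetric] by linarith
  qed
  have "(\<lambda>i. z / (1 + z * (1 / real (Suc i)))) \<longlonglongrightarrow> z / (1 + z * 0)"
    by (intro tendsto_divide tendsto_add tendsto_mult tendsto_const LIMSEQ_Suc[OF lim_1_over_n]) auto
  then have lim: "(\<lambda>i. z / (1 + z * (1 / real (Suc i)))) \<longlonglongrightarrow> z"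
    by simp
  show "(\<lambda>i. real (Suc i) - real (Suc i) * exp (- (z / real (Suc i)))) \<longlonglongrightarrow> z"
    by (rule tendsto_sandwich[OF _ _ lim tendsto_const]; intro always_eventually allI low up)
  show "real (Suc i) - real (Suc i) * exp (- (z / real (Suc i))) \<le> z"
    by (rule up)
qed

text \<open>The discrete measure with weight \<open>p\<^sub>k\<close> at \<open>k/b\<close> has transform \<open>\<Sum> p\<^sub>k (e\<^sup>-\<^sup>z\<^sup>/\<^sup>b)\<^sup>k = h(b - b e\<^sup>-\<^sup>z\<^sup>/\<^sup>b)\<close>, which tends to
\<open>h(z)\<close> as \<open>b \<rightarrow> \<infinity>\<close>. Tightness holds because the transform at a small \<open>z\<close> is near \<open>1\<close> uniformly in \<open>b\<close>.
Helly's selection theorem then yields a limit measure with transform \<open>h\<close>.\<close>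

theorem Bernstein:
  assumes cm: "completely_monotone h" and h1: "(h \<longlongrightarrow> 1) (at_right 0)"
  shows "\<exists>\<nu>. represents \<nu> h"
proof -
  define b where "b i = real (Suc i)" for i
  have b: "b i > 0" for i by (simp add: b_def)
  have "\<exists>p. \<forall>r. 0 < r \<longrightarrow> r < 1 \<longrightarrow> (\<lambda>k. pmf p k * r ^ k) sums h (b i - b i * r)" for i
    by (rule completely_monotone_sampling_pmf[OF cm h1 b[of i]]) blast
  then obtain p :: "nat \<Rightarrow> nat pmf" where
    p: "\<And>i r. 0 < r \<Longrightarrow> r < 1 \<Longrightarrow> (\<lambda>k. pmf (p i) k * r ^ k) sums h (b i - b i * r)"
    by metis
  define \<mu> where "\<mu> i = distr (measure_pmf (p i)) borel (\<lambda>k. real k / b i)" for i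
  \<comment> \<open>Constant on the negative half-line, so that the test function is bounded and
    continuous on the whole line.\<close>
  define e where "e z s = exp (- (z * max s 0))" for z s :: real
  define z' where "z' z i = b i - b i * exp (- (z / b i))" for z i
  have mu: "real_distribution (\<mu> i)" for i
    unfolding \<mu>_def by (rule prob_space.real_distribution_distr[OF measure_pmf.prob_space_axioms]) simp
  interpret mu: real_distribution "\<mu> i" for i by (rule mu)
  have int_mu: "(\<integral>s. f s \<partial>\<mu> i) = (\<integral>k. f (real k / b i) \<partial>measure_pmf (p i))"
    if "f \<in> borel_measurable borel" for f :: "real \<Rightarrow> real" and i
    unfolding \<mu>_def using that by (intro integral_distr) auto
  have e_meas [measurable]: "e z \<in> borel_measurable borel" for z
    unfolding e_def by measurable
  have e_bound: "0 \<le> e z s" "e z s \<le> 1" if "z > 0" for z s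
    using that by (auto simp: e_def)
  have int_e: "(\<integral>s. e z s \<partial>\<mu> i) = h (z' z i)" if z: "z > 0" for z i
  proof -
    have "(\<integral>s. e z s \<partial>\<mu> i) = (\<integral>k. exp (- (z / b i)) ^ k \<partial>measure_pmf (p i))"
      using b[of i] unfolding int_mu[OF e_meas]
      by (intro Bochner_Integration.integral_cong refl)
        (simp add: e_def exp_of_nat_mult[symmetric] max_def mult.commute divide_le_0_iff)
    also have "\<dots> = h (z' z i)"
      unfolding z'_def using z b by (intro integral_nat_pmf p) auto
    finally show ?thesis .
  qed
  have z'_lim: "z' z \<longlonglongrightarrow> z" and z'_le: "z' z i \<le> z" and z'_pos: "z' z i > 0" if "z > 0" for z i
    using Bernstein_sampling_limit[of z] that b[of i] by (auto simp: z'_def[abs_def] b_def)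
  have mono: "h y \<le> h x" if "0 < x" "x \<le> y" for x y
    using completely_monotone_antimono[OF cm that, of 0] by simp
  have tight: "tight \<mu>"
    unfolding tight_def
  proof (intro conjI allI impI mu)
    fix \<epsilon> :: real assume \<epsilon>: "\<epsilon> > 0"
    have "\<forall>\<^sub>F z in at_right 0. h z > 1 - \<epsilon> / 2"
      using h1 by (rule order_tendstoD) (use \<epsilon> in simp)
    then obtain z where z: "z > 0" "h z > 1 - \<epsilon> / 2"
      unfolding eventually_at_right_field by (metis dense)
    \<comment> \<open>A Markov-type bound: \<open>2 e\<^sup>-\<^sup>z\<^sup>s - 1\<close> is at most \<open>1\<close>, and is negative once \<open>s > 1/z\<close>. The left
      endpoint only has to lie below the support.\<close>
    show "\<exists>a c. a < c \<and> (\<forall>i. 1 - \<epsilon> < measure (\<mu> i) {a<..c})"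
    proof (rule exI[of _ "-1"], rule exI[of _ "1 / z"], intro conjI allI)
      show "- 1 < 1 / z" using z by (simp add: less_trans[of "-1" 0])
      fix i
      have "2 * h z - 1 \<le> 2 * h (z' z i) - 1"
        using mono[OF z'_pos z'_le] z by simp
      also have "\<dots> = (\<integral>s. 2 * e z s - 1 \<partial>\<mu> i)"
      proof -
        have "integrable (\<mu> i) (e z)"
          using e_bound[OF z(1)] by (intro mu.integrable_const_bound[of _ 1]) auto
        then show ?thesis
          using int_e[OF z(1)] mu.prob_space by simp
      qed
      also have "\<dots> = (\<integral>k. 2 * e z (real k / b i) - 1 \<partial>measure_pmf (p i))"
        by (intro int_mu) measurable
      also have "\<dots> \<le> (\<integral>k. indicator {-1<..1 / z} (real k / b i) \<partial>measure_pmf (p i))"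
      proof (rule integral_mono)
        show "integrable (measure_pmf (p i)) (\<lambda>k. 2 * e z (real k / b i) - 1)"
          using e_bound[OF z(1)]
          by (intro measure_pmf.integrable_const_bound[of _ 1]) (auto simp: abs_le_iff)
        show "integrable (measure_pmf (p i)) (\<lambda>k. indicat_real {-1<..1 / z} (real k / b i))"
          by (intro measure_pmf.integrable_const_bound[of _ 1]) (auto simp: indicator_def)
        fix k
        have s: "real k / b i \<ge> 0" using b[of i] by simp
        show "2 * e z (real k / b i) - 1 \<le> indicat_real {-1<..1 / z} (real k / b i)"
        proof (cases "real k / b i \<le> 1 / z")
          case True
          then show ?thesis using e_bound[OF z(1), of "real k / b i"] s by simp
        next
          case False
          then have "1 \<le> z * (real k / b i)" using z by (simp add: field_simps)
          then have "exp 1 \<le> exp (z * (real k / b i))" by simp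
          moreover have "2 \<le> exp (1::real)" using exp_ge_add_one_self[of 1] by simp
          ultimately have "2 \<le> exp (z * (real k / b i))" by linarith
          then have "inverse (exp (z * (real k / b i))) \<le> inverse 2"
            by (intro le_imp_inverse_le) auto
          then have "e z (real k / b i) \<le> 1 / 2"
            using s by (simp add: e_def exp_minus max_absorb1)
          then show ?thesis by (simp add: indicator_def)
        qed
      qed
      also have "\<dots> = (\<integral>s. indicator {-1<..1 / z} s \<partial>\<mu> i)"
        by (intro int_mu[symmetric]) measurable
      also have "\<dots> = measure (\<mu> i) {-1<..1 / z}"
        by simp
      finally show "1 - \<epsilon> < measure (\<mu> i) {-1<..1 / z}"
        using z by linarith
    qed
  qed
  obtain r \<nu> where r: "strict_mono r" and nu: "real_distribution \<nu>"
    and conv: "weak_conv_m (\<mu> \<circ> (\<lambda>i. i) \<circ> r) \<nu>"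
    using tight_imp_convergent_subsubsequence[OF tight, of "\<lambda>i. i"] by (auto simp: strict_mono_def)
  interpret nu: real_distribution \<nu> by (rule nu)
  have conv_int: "(\<lambda>i. \<integral>s. f s \<partial>\<mu> (r i)) \<longlonglongrightarrow> (\<integral>s. f s \<partial>\<nu>)"
    if "continuous_on UNIV f" "\<And>s. norm (f s) \<le> 1" for f :: "real \<Rightarrow> real"
    using weak_conv_imp_integral_bdd_continuous_conv[of "\<mu> \<circ> (\<lambda>i. i) \<circ> r" \<nu>, OF _ nu conv _ that(2)] mu that(1)
    by (simp add: continuous_on_eq_continuous_at)
  have nu_e: "(\<integral>s. e z s \<partial>\<nu>) = h z" if z: "z > 0" for z
  proof -
    have "isCont h z"
      using has_derivs_Suc[OF completely_monotone_has_derivs[OF cm] z, of 0] by (auto intro: DERIV_isCont)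
    then have "(\<lambda>i. h (z' z (r i))) \<longlonglongrightarrow> h z"
      using z'_lim[OF z] LIMSEQ_subseq_LIMSEQ[OF _ r, of "z' z" z]
      by (intro isCont_tendsto_compose[of z h]) (auto simp: comp_def)
    moreover have "(\<lambda>i. h (z' z (r i))) \<longlonglongrightarrow> (\<integral>s. e z s \<partial>\<nu>)"
    proof -
      have "continuous_on UNIV (e z)"
        unfolding e_def by (intro continuous_intros)
      then show ?thesis
        using conv_int[of "e z"] e_bound[OF z] unfolding int_e[OF z] by simp
    qed
    ultimately show ?thesis
      using LIMSEQ_unique by blast
  qed
  have nu_pos: "AE s in \<nu>. 0 \<le> s"
  proof -
    \<comment> \<open>A bounded continuous function that is positive exactly on the negative half-line.\<close>
    define \<psi> :: "real \<Rightarrow> real" where "\<psi> s = min 1 (max 0 (- s))" for s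
    have [measurable]: "\<psi> \<in> borel_measurable borel" unfolding \<psi>_def by measurable
    have "(\<integral>s. \<psi> s \<partial>\<mu> i) = 0" for i
    proof -
      have "\<psi> (real k / b i) = 0" for k
        using b[of i] by (simp add: \<psi>_def max_absorb1)
      then show ?thesis by (subst int_mu) auto
    qed
    moreover have "(\<lambda>i. \<integral>s. \<psi> s \<partial>\<mu> (r i)) \<longlonglongrightarrow> (\<integral>s. \<psi> s \<partial>\<nu>)"
    proof (rule conv_int)
      show "continuous_on UNIV \<psi>"
        unfolding \<psi>_def by (intro continuous_intros)
    qed (auto simp: \<psi>_def)
    ultimately have "(\<integral>s. \<psi> s \<partial>\<nu>) = 0"
      by (simp add: LIMSEQ_const_iff)
    moreover have "integrable \<nu> \<psi>"
      by (intro nu.integrable_const_bound[of _ 1]) (auto simp: \<psi>_def)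
    ultimately have "AE s in \<nu>. \<psi> s = 0"
      by (subst (asm) integral_nonneg_eq_0_iff_AE) (auto simp: \<psi>_def)
    then show ?thesis
      by eventually_elim (auto simp: \<psi>_def min_def max_def split: if_splits)
  qed
  have "represents (restrict_space \<nu> {0..}) h"
    unfolding represents_def
  proof (intro conjI allI impI)
    show "sets (restrict_space \<nu> {0..}) = sets (restrict_space borel {0..})"
      by (intro sets_restrict_space_cong) simp
    fix z :: real assume z: "z > 0"
    have "integrable \<nu> (e z)"
      using e_bound[OF z] by (intro nu.integrable_const_bound[of _ 1]) auto
    then have "has_bochner_integral \<nu> (e z) (h z)"
      using nu_e[OF z] by (simp add: has_bochner_integral_iff)
    then have "has_bochner_integral \<nu> (\<lambda>s. indicator {0..} s *\<^sub>R exp (- (z * s))) (h z)"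
      using nu_pos by (subst has_bochner_integral_cong_AE[where g="e z"])
        (auto simp: e_def elim!: eventually_mono)
    then show "has_bochner_integral (restrict_space \<nu> {0..}) (\<lambda>s. exp (- (z * s))) (h z)"
      by (simp add: has_bochner_integral_iff integrable_restrict_space integral_restrict_space)
  qed
  then show ?thesis by blast
qed

section \<open>Derivatives at zero of a completely monotone function\<close>

text \<open>The limit is taken in the extended reals because the derivatives may be unbounded near \<open>0\<close>.\<close>

lemma antimono_tendsto_at_right_0:
  fixes \<phi> :: "real \<Rightarrow> real"
  assumes "\<And>x y. 0 < x \<Longrightarrow> x \<le> y \<Longrightarrow> \<phi> y \<le> \<phi> x"
  shows "((\<lambda>z. ereal (\<phi> z)) \<longlongrightarrow> (SUP z\<in>{0<..}. ereal (\<phi> z))) (at_right 0)"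
proof (rule order_tendstoI)
  fix l assume "l < (SUP z\<in>{0<..}. ereal (\<phi> z))"
  then obtain w where w: "w > 0" "l < ereal (\<phi> w)" by (auto simp: less_SUP_iff)
  have "l < ereal (\<phi> z)" if "0 < z" "z < w" for z
    using w assms[of z w] that by (simp add: less_le_trans)
  then show "\<forall>\<^sub>F z in at_right 0. l < ereal (\<phi> z)"
    using w by (auto simp: eventually_at_right_field)
next
  fix u assume u: "(SUP z\<in>{0<..}. ereal (\<phi> z)) < u"
  have "ereal (\<phi> z) < u" if "0 < z" for z
    using u that by (meson SUP_upper greaterThan_iff le_less_trans)
  then show "\<forall>\<^sub>F z in at_right 0. ereal (\<phi> z) < u"
    by (auto simp: eventually_at_filter)
qed

lemma tendsto_deriv_at_0:
  assumes cm: "completely_monotone g"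
  shows "((\<lambda>z. ereal ((deriv ^^ k) g z)) \<longlongrightarrow> deriv_at_0 k g) (at_right 0)"
proof -
  define L where "L = (SUP z\<in>{0<..}. ereal ((- 1) ^ k * (deriv ^^ k) g z))"
  have lim: "((\<lambda>z. ereal ((- 1) ^ k * (deriv ^^ k) g z)) \<longlongrightarrow> L) (at_right 0)"
    unfolding L_def by (rule antimono_tendsto_at_right_0) (rule completely_monotone_antimono[OF cm])
  have "\<exists>l. ((\<lambda>z. ereal ((deriv ^^ k) g z)) \<longlongrightarrow> l) (at_right 0)"
  proof (cases "even k")
    case True
    then show ?thesis using lim by auto
  next
    case False
    then have "((\<lambda>z. - ereal (- (deriv ^^ k) g z)) \<longlongrightarrow> - L) (at_right 0)"
      using lim by (intro tendsto_uminus_ereal) simp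
    then show ?thesis by auto
  qed
  then obtain l where l: "((\<lambda>z. ereal ((deriv ^^ k) g z)) \<longlongrightarrow> l) (at_right 0)" by blast
  then have "deriv_at_0 k g = l"
    unfolding deriv_at_0_def by (intro tendsto_Lim) auto
  with l show ?thesis by simp
qed

lemma deriv_at_0_nonneg:
  assumes cm: "completely_monotone g" and k: "even k"
  shows "0 \<le> deriv_at_0 k g"
proof (rule tendsto_lowerbound[OF tendsto_deriv_at_0[OF cm]])
  show "\<forall>\<^sub>F z in at_right 0. 0 \<le> ereal ((deriv ^^ k) g z)"
    using completely_monotoneD[OF cm, of _ k] k by (auto simp: eventually_at_filter)
qed simp

lemma has_jet_deriv_at_0:
  assumes cm: "completely_monotone g" and fin: "\<And>k. k \<le> m \<Longrightarrow> \<bar>deriv_at_0 k g\<bar> \<noteq> \<infinity>"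
  shows "has_jet m g (\<lambda>k. real_of_ereal (deriv_at_0 k g))"
proof -
  have "((deriv ^^ k) g \<longlongrightarrow> real_of_ereal (deriv_at_0 k g)) (at_right 0)" if "k \<le> m" for k
    using tendsto_deriv_at_0[OF cm, of k] ereal_real'[OF fin[OF that]] lim_ereal by metis
  then show ?thesis
    using completely_monotone_has_derivs[OF cm] unfolding has_jet_def by blast
qed

section \<open>Moments of the representing measures\<close>

lemma has_bochner_integral_nonneg_space:
  fixes f :: "'b \<Rightarrow> real"
  assumes "has_bochner_integral M f x" "\<And>s. s \<in> space M \<Longrightarrow> 0 \<le> f s"
  shows "0 \<le> x"
  using assms Bochner_Integration.integral_nonneg[of M f] by (simp add: has_bochner_integral_iff)

text \<open>Let \<open>X\<close> be distributed according to the representing measure. The numbers \<open>c2\<close>, \<open>-c3\<close>, \<open>c4\<close> are the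
central moments of \<open>X\<close>, which has mean \<open>1\<close>. Each inequality is a consequence of the nonnegativity of
means of polynomials in \<open>X\<close> that are nonnegative for \<open>X \<ge> 0\<close>.\<close>

lemma normalized_jet_bounds:
  assumes cm: "completely_monotone g" and jet: "has_jet 4 g a" and a: "a 0 = 1" "a 1 = - 1"
  defines "c2 \<equiv> a 2 - 1" and "c3 \<equiv> a 3 + 3 * a 2 - 2" and "c4 \<equiv> a 4 + 4 * a 3 + 6 * a 2 - 3"
  shows "0 \<le> c2" "c2\<^sup>2 \<le> c4" "c4 \<le> a 4 - 1" "\<bar>c3\<bar> \<le> a 4 - 1"
proof -
  have "(g \<longlongrightarrow> 1) (at_right 0)"
    using has_jet_higher_deriv[OF jet, of 0] a by simp
  from Bernstein[OF cm this] obtain \<nu> where rep: "represents \<nu> g" by blast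
  have space: "space \<nu> = {0..}" by (rule represents_space[OF rep])
  note m = represents_moments[OF rep jet]
  have m1: "has_bochner_integral \<nu> (\<lambda>s. 1) (1 :: real)" "has_bochner_integral \<nu> (\<lambda>s. s) 1"
    "has_bochner_integral \<nu> (\<lambda>s. s ^ 2) (a 2)" "has_bochner_integral \<nu> (\<lambda>s. s ^ 3) (- a 3)"
    "has_bochner_integral \<nu> (\<lambda>s. s ^ 4) (a 4)"
    using m[of 0] m[of 1] m[of 2] m[of 3] m[of 4] a by simp_all
  note intros = has_bochner_integral_add has_bochner_integral_diff has_bochner_integral_mult_right m1
  have quartic: "0 \<le> b0 + b1 + b2 * a 2 - b3 * a 3 + b4 * a 4"
    if "\<And>s. s \<ge> 0 \<Longrightarrow> 0 \<le> b0 + b1 * s + b2 * s ^ 2 + b3 * s ^ 3 + b4 * s ^ 4" for b0 b1 b2 b3 b4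
  proof -
    have "has_bochner_integral \<nu> (\<lambda>s. b0 * 1 + b1 * s + b2 * s ^ 2 + b3 * s ^ 3 + b4 * s ^ 4)
        (b0 * 1 + b1 * 1 + b2 * a 2 + b3 * (- a 3) + b4 * a 4)"
      by (intro intros)
    from has_bochner_integral_nonneg_space[OF this] show ?thesis
      using that space by simp
  qed
  \<comment> \<open>Mean of \<open>(X - 1)\<^sup>2\<close>.\<close>
  have "0 \<le> 1 + (- 2) + 1 * a 2 - 0 * a 3 + 0 * a 4"
  proof (rule quartic)
    fix s :: real
    have "0 \<le> (s - 1) ^ 2" by simp
    then show "0 \<le> 1 + - 2 * s + 1 * s ^ 2 + 0 * s ^ 3 + 0 * s ^ 4"
      by (simp add: power2_eq_square algebra_simps)
  qed
  then show c2: "0 \<le> c2" by (simp add: c2_def)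
  \<comment> \<open>Mean of \<open>X(X - 1)\<^sup>2\<close>; here \<open>X \<ge> 0\<close> is used.\<close>
  have "0 \<le> 0 + 1 + (- 2) * a 2 - 1 * a 3 + 0 * a 4"
  proof (rule quartic)
    fix s :: real assume "s \<ge> 0"
    then have "0 \<le> s * (s - 1) ^ 2" by simp
    then show "0 \<le> 0 + 1 * s + - 2 * s ^ 2 + 1 * s ^ 3 + 0 * s ^ 4"
      by (simp add: eval_nat_numeral algebra_simps)
  qed
  then show c4: "c4 \<le> a 4 - 1" using c2 by (simp add: c4_def c2_def)
  \<comment> \<open>Mean of \<open>(X\<^sup>2 - 1)\<^sup>2\<close>.\<close>
  have "0 \<le> 1 + 0 + (- 2) * a 2 - 0 * a 3 + 1 * a 4"
  proof (rule quartic)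
    fix s :: real
    have "0 \<le> (s ^ 2 - 1) ^ 2" by simp
    then show "0 \<le> 1 + 0 * s + - 2 * s ^ 2 + 0 * s ^ 3 + 1 * s ^ 4"
      by (simp add: eval_nat_numeral algebra_simps)
  qed
  then have c2': "c2 \<le> a 4 - 1" using c2 by (simp add: c2_def)
  \<comment> \<open>Variance of \<open>(X - 1)\<^sup>2\<close>.\<close>
  have "0 \<le> (1 - c2)\<^sup>2 + (- 4 * (1 - c2)) + (4 + 2 * (1 - c2)) * a 2 - (- 4) * a 3 + 1 * a 4"
  proof (rule quartic)
    fix s :: real
    have "0 \<le> ((s - 1) ^ 2 - c2) ^ 2" by simp
    then show "0 \<le> (1 - c2)\<^sup>2 + - 4 * (1 - c2) * s + (4 + 2 * (1 - c2)) * s ^ 2 + - 4 * s ^ 3 + 1 * s ^ 4"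
      by (simp add: eval_nat_numeral algebra_simps)
  qed
  then show "c2\<^sup>2 \<le> c4"
    by (simp add: c2_def c4_def power2_eq_square algebra_simps)
  \<comment> \<open>Means of \<open>U\<^sup>2(U + 1)\<^sup>2\<close> and \<open>U\<^sup>2(U - 1)\<^sup>2\<close> with \<open>U = X - 1\<close>: together they bound the third
    central moment by the average of the second and the fourth.\<close>
  have "0 \<le> 0 + 0 + 1 * a 2 - (- 2) * a 3 + 1 * a 4"
  proof (rule quartic)
    fix s :: real
    have "0 \<le> (s * (s - 1)) ^ 2" by simp
    then show "0 \<le> 0 + 0 * s + 1 * s ^ 2 + - 2 * s ^ 3 + 1 * s ^ 4"
      by (simp add: eval_nat_numeral algebra_simps)
  qed
  then have p1: "2 * c3 \<le> c2 + c4"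
    by (simp add: c2_def c3_def c4_def)
  have "0 \<le> 4 + (- 12) + 13 * a 2 - (- 6) * a 3 + 1 * a 4"
  proof (rule quartic)
    fix s :: real
    have "0 \<le> ((s - 1) * (s - 2)) ^ 2" by simp
    then show "0 \<le> 4 + - 12 * s + 13 * s ^ 2 + - 6 * s ^ 3 + 1 * s ^ 4"
      by (simp add: eval_nat_numeral algebra_simps)
  qed
  then have p2: "- 2 * c3 \<le> c2 + c4"
    by (simp add: c2_def c3_def c4_def)
  show "\<bar>c3\<bar> \<le> a 4 - 1"
    using p1 p2 c2' c4 by linarith
qed

text \<open>With \<open>u = t/n\<close> the centered transform \<open>e\<^sup>t\<^sup>zh(z)\<close> equals \<open>(e\<^sup>u\<^sup>zg(uz))\<^sup>n\<close>, and the derivatives of \<open>e\<^sup>zg(z)\<close> at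
\<open>0+\<close> are, up to sign, the central moments of the measure of \<open>g\<close>.\<close>

lemma mean_power_moments:
  assumes cm: "completely_monotone g" and jet: "has_jet 4 g a" and a: "a 0 = 1" "a 1 = - 1"
    and t: "t > 0" and n: "n \<ge> (1::nat)"
  defines "\<nu> \<equiv> representing_measure (\<lambda>z. g (t * z / real n) ^ n)"
  shows "represents \<nu> (\<lambda>z. g (t * z / real n) ^ n)"
    and "has_bochner_integral \<nu> (\<lambda>s. (s - t) ^ 0) 1"
    and "has_bochner_integral \<nu> (\<lambda>s. (s - t) ^ 1) 0"
    and "has_bochner_integral \<nu> (\<lambda>s. (s - t) ^ 2) (t\<^sup>2 * (a 2 - 1) / n)"
    and "has_bochner_integral \<nu> (\<lambda>s. (s - t) ^ 3) (- (t ^ 3 * (a 3 + 3 * a 2 - 2) / (real n)\<^sup>2))"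
    and "has_bochner_integral \<nu> (\<lambda>s. (s - t) ^ 4)
       (t ^ 4 * ((a 4 + 4 * a 3 + 6 * a 2 - 3) + 3 * (real n - 1) * (a 2 - 1)\<^sup>2) / real n ^ 3)"
proof -
  define h where "h = (\<lambda>z. g (t * z / real n) ^ n)"
  define u where "u = t / real n"
  define c where "c k = (\<Sum>i\<le>k. real (k choose i) * 1 ^ i * a (k - i))" for k
  define J where "J k = (if k = 0 then 1
    else real n * (u ^ k * c k) + (if k = 4 then 3 * real n * (real n - 1) * (u\<^sup>2 * c 2)\<^sup>2 else 0))" for k
  have n0: "real n > 0" using n by simp
  have u: "u > 0" using t n0 by (simp add: u_def)
  have c: "c 0 = 1" "c 1 = 0" "c 2 = a 2 - 1" "c 3 = a 3 + 3 * a 2 - 2"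
    "c 4 = a 4 + 4 * a 3 + 6 * a 2 - 3"
    unfolding c_def using a by (simp_all only: binomial_sums_up_to_4) simp_all
  have h_eq: "h = (\<lambda>z. g (u * z) ^ n)" by (rule ext) (simp add: h_def u_def)
  have "completely_monotone h"
    unfolding h_eq by (intro completely_monotone_power completely_monotone_scale cm u)
  have "has_jet 4 (\<lambda>z. exp (1 * z) * g z) c"
    using has_jet_mult[OF has_jet_exp jet, of 1] by (rule has_jet_cong) (simp add: c_def)
  from has_jet_scale[OF this u]
  have "has_jet 4 (\<lambda>z. (exp (1 * (u * z)) * g (u * z)) ^ n) J"
    using has_jet_power[of _ "\<lambda>k. u ^ k * c k" n] c by (simp add: J_def[abs_def])
  moreover have "(exp (1 * (u * z)) * g (u * z)) ^ n = exp (t * z) * h z" for z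
    using n0 by (simp add: h_eq power_mult_distrib u_def flip: exp_of_nat_mult)
  ultimately have ejet: "has_jet 4 (\<lambda>z. exp (t * z) * h z) J" by simp
  \<comment> \<open>The power rule for jets requires a vanishing first derivative, which \<open>h\<close> itself does not
    have; its derivatives are recovered from those of \<open>e\<^sup>t\<^sup>zh(z)\<close>.\<close>
  define b where "b k = (\<Sum>i\<le>k. real (k choose i) * (- t) ^ i * J (k - i))" for k
  have hjet: "has_jet 4 h b"
    using has_jet_mult[OF has_jet_exp ejet, of "- t"]
    by (simp add: b_def[abs_def] mult.assoc[symmetric] flip: exp_add)
  have "(h \<longlongrightarrow> 1) (at_right 0)"
    using has_jet_higher_deriv[OF hjet, of 0] by (simp add: b_def J_def)
  from Bernstein[OF \<open>completely_monotone h\<close> this]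
  have rep: "represents \<nu> h"
    unfolding \<nu>_def representing_measure_def h_def by (rule someI_ex)
  then show "represents \<nu> (\<lambda>z. g (t * z / real n) ^ n)" by (simp add: h_def)
  have moments: "has_bochner_integral \<nu> (\<lambda>s. (s - t) ^ k) ((- 1) ^ k * J k)" if "k \<le> 4" for k
    using represents_central_moments[OF rep hjet that ejet] .
  show "has_bochner_integral \<nu> (\<lambda>s. (s - t) ^ 0) 1"
    using moments[of 0] by (simp add: J_def)
  show "has_bochner_integral \<nu> (\<lambda>s. (s - t) ^ 1) 0"
    using moments[of 1] c by (simp add: J_def)
  have "(- 1) ^ 2 * J 2 = t\<^sup>2 * (a 2 - 1) / n"
    using n0 by (simp add: J_def c u_def power2_eq_square)
  then show "has_bochner_integral \<nu> (\<lambda>s. (s - t) ^ 2) (t\<^sup>2 * (a 2 - 1) / n)"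
    using moments[of 2] by (simp only:)
  have "(- 1) ^ 3 * J 3 = - (t ^ 3 * (a 3 + 3 * a 2 - 2) / (real n)\<^sup>2)"
  proof -
    have "J 3 = real n * u ^ 3 * c 3" by (simp add: J_def)
    moreover have "real n * u ^ 3 = t ^ 3 / (real n)\<^sup>2"
      using n0 by (simp add: u_def eval_nat_numeral)
    ultimately show ?thesis by (simp add: c)
  qed
  then show "has_bochner_integral \<nu> (\<lambda>s. (s - t) ^ 3) (- (t ^ 3 * (a 3 + 3 * a 2 - 2) / (real n)\<^sup>2))"
    using moments[of 3] by (simp only:)
  have "(- 1) ^ 4 * J 4 =
    t ^ 4 * ((a 4 + 4 * a 3 + 6 * a 2 - 3) + 3 * (real n - 1) * (a 2 - 1)\<^sup>2) / real n ^ 3"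
  proof -
    have "J 4 = real n * u ^ 4 * (c 4 + 3 * (real n - 1) * (c 2)\<^sup>2)"
      by (simp add: J_def power_mult_distrib algebra_simps flip: power_mult)
    moreover have "real n * u ^ 4 = t ^ 4 / real n ^ 3"
      using n0 by (simp add: u_def eval_nat_numeral)
    ultimately show ?thesis by (simp add: c)
  qed
  then show "has_bochner_integral \<nu> (\<lambda>s. (s - t) ^ 4)
       (t ^ 4 * ((a 4 + 4 * a 3 + 6 * a 2 - 3) + 3 * (real n - 1) * (a 2 - 1)\<^sup>2) / real n ^ 3)"
    using moments[of 4] by (simp only:)
qed

text \<open>The Cauchy--Schwarz inequality for \<open>\<bar>s - t\<bar>\<close> and \<open>(s - t)\<^sup>2\<close>, obtained from the nonnegative quadratic form
\<open>(\<alpha>, \<beta>) \<mapsto> \<integral> (\<alpha>\<bar>s - t\<bar> - \<beta>(s - t)\<^sup>2)\<^sup>2\<close>.\<close>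

lemma third_absolute_moment_le:
  fixes M :: "real measure"
  assumes 2: "has_bochner_integral M (\<lambda>s. (s - t) ^ 2) p" and 4: "has_bochner_integral M (\<lambda>s. (s - t) ^ 4) q"
    and meas: "(\<lambda>s. s) \<in> borel_measurable M"
  shows "integrable M (\<lambda>s. \<bar>s - t\<bar> ^ 3)" "(\<integral>s. \<bar>s - t\<bar> ^ 3 \<partial>M) \<le> sqrt (p * q)"
proof -
  note [measurable] = meas
  have sq: "\<bar>u\<bar> ^ 2 = u ^ 2" "\<bar>u\<bar> ^ 4 = u ^ 4" for u :: real
    by (simp_all add: power_even_abs)
  have amgm: "2 * \<bar>u\<bar> ^ 3 \<le> u ^ 2 + u ^ 4" for u :: real
  proof -
    have "0 \<le> (\<bar>u\<bar> - \<bar>u\<bar> ^ 2) ^ 2" by simp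
    also have "\<dots> = \<bar>u\<bar> ^ 2 - 2 * \<bar>u\<bar> ^ 3 + \<bar>u\<bar> ^ 4"
      by (simp add: eval_nat_numeral algebra_simps)
    finally show ?thesis unfolding sq by simp
  qed
  show int: "integrable M (\<lambda>s. \<bar>s - t\<bar> ^ 3)"
  proof (rule Bochner_Integration.integrable_bound)
    show "integrable M (\<lambda>s. (s - t) ^ 2 + (s - t) ^ 4)"
      using 2 4 by (auto simp: has_bochner_integral_iff)
    show "AE s in M. norm (\<bar>s - t\<bar> ^ 3) \<le> norm ((s - t) ^ 2 + (s - t) ^ 4)"
    proof (rule AE_I2)
      fix s
      have "\<bar>s - t\<bar> ^ 3 \<le> (s - t) ^ 2 + (s - t) ^ 4"
        using amgm[of "s - t"] zero_le_power[of "\<bar>s - t\<bar>" 3] by linarith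
      then show "norm (\<bar>s - t\<bar> ^ 3) \<le> norm ((s - t) ^ 2 + (s - t) ^ 4)"
        by simp
    qed
  qed measurable
  define m where "m = (\<integral>s. \<bar>s - t\<bar> ^ 3 \<partial>M)"
  have m: "has_bochner_integral M (\<lambda>s. \<bar>s - t\<bar> ^ 3) m"
    using int by (simp add: m_def has_bochner_integral_iff)
  have m0: "m \<ge> 0" unfolding m_def by simp
  have p: "p \<ge> 0" by (rule has_bochner_integral_nonneg_space[OF 2]) simp
  have q: "q \<ge> 0" by (rule has_bochner_integral_nonneg_space[OF 4]) simp
  have quad: "0 \<le> \<alpha>\<^sup>2 * p - 2 * \<alpha> * \<beta> * m + \<beta>\<^sup>2 * q" for \<alpha> \<beta>
  proof (rule has_bochner_integral_nonneg_space)
    show "has_bochner_integral M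
      (\<lambda>s. \<alpha>\<^sup>2 * (s - t) ^ 2 - 2 * \<alpha> * \<beta> * \<bar>s - t\<bar> ^ 3 + \<beta>\<^sup>2 * (s - t) ^ 4)
      (\<alpha>\<^sup>2 * p - 2 * \<alpha> * \<beta> * m + \<beta>\<^sup>2 * q)"
      by (intro has_bochner_integral_add has_bochner_integral_diff has_bochner_integral_mult_right 2 4 m)
    fix s
    have "0 \<le> (\<alpha> * \<bar>s - t\<bar> - \<beta> * \<bar>s - t\<bar> ^ 2) ^ 2" by simp
    also have "\<dots> = \<alpha>\<^sup>2 * \<bar>s - t\<bar> ^ 2 - 2 * \<alpha> * \<beta> * \<bar>s - t\<bar> ^ 3 + \<beta>\<^sup>2 * \<bar>s - t\<bar> ^ 4"
      by (simp add: eval_nat_numeral algebra_simps)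
    finally show "0 \<le> \<alpha>\<^sup>2 * (s - t) ^ 2 - 2 * \<alpha> * \<beta> * \<bar>s - t\<bar> ^ 3 + \<beta>\<^sup>2 * (s - t) ^ 4"
      unfolding sq .
  qed
  have "m\<^sup>2 \<le> p * q"
  proof (cases "p = 0")
    case True
    have "m = 0"
    proof (rule ccontr)
      assume "m \<noteq> 0"
      then show False
        \<comment> \<open>With \<open>p = 0\<close> the form is affine in \<open>\<alpha>\<close>, and this \<open>\<alpha>\<close> gives it the value \<open>-1\<close>.\<close>
        using quad[of "(q + 1) / (2 * m)" 1] True by (simp add: field_simps)
    qed
    then show ?thesis using True by simp
  next
    case False
    have "0 \<le> p * (p * q - m\<^sup>2)"
      using quad[of m p] by (simp add: power2_eq_square algebra_simps)
    then show ?thesis using False p by (simp add: zero_le_mult_iff)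
  qed
  then show "(\<integral>s. \<bar>s - t\<bar> ^ 3 \<partial>M) \<le> sqrt (p * q)"
    unfolding m_def[symmetric] by (rule real_le_rsqrt)
qed

section \<open>Bochner integrals in nonseparable spaces\<close>

abbreviation "simple_bochner_integrable \<equiv> Bochner_Integration.simple_bochner_integrable"
abbreviation "simple_bochner_integral \<equiv> Bochner_Integration.simple_bochner_integral"

text \<open>In a nonseparable space the difference of two measurable functions need not be measurable. A simple
function takes finitely many values, so on finitely many measurable pieces the difference is a
translate of \<open>f\<close>.\<close>

lemma norm_diff_simple_measurable:
  assumes f: "f \<in> borel_measurable M" and s: "simple_function M s"
  shows "(\<lambda>x. norm (f x - s x)) \<in> borel_measurable M"
proof (rule measurable_compose_countable'[where f="\<lambda>i x. norm (f x - i)" and g=s and I="s ` space M"])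
  show "(\<lambda>x. norm (f x - i)) \<in> borel_measurable M" for i
    by (intro measurable_compose[OF f] borel_measurable_continuous_onI continuous_intros)
  show "s \<in> measurable M (count_space (s ` space M))"
    using s by (subst measurable_count_space_eq_countable)
      (auto simp: simple_function_def countable_finite)
  show "countable (s ` space M)"
    using s by (simp add: simple_function_def countable_finite)
qed

text \<open>The real function \<open>q\<close> stands in for \<open>norm (f x - g x)\<close>, which may fail to be measurable.\<close>

lemma simple_bochner_integral_dist_le:
  fixes f g :: "'b \<Rightarrow> 'a::real_normed_vector"
  assumes f: "f \<in> borel_measurable M" and g: "g \<in> borel_measurable M"
    and q: "q \<in> borel_measurable M" "\<And>x. x \<in> space M \<Longrightarrow> norm (f x - g x) \<le> q x"
    and s: "simple_bochner_integrable M s" and r: "simple_bochner_integrable M r"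
  shows "ennreal (norm (simple_bochner_integral M s - simple_bochner_integral M r)) \<le>
    (\<integral>\<^sup>+x. norm (f x - s x) \<partial>M) + (\<integral>\<^sup>+x. ennreal (q x) \<partial>M) + (\<integral>\<^sup>+x. norm (g x - r x) \<partial>M)"
proof -
  have [measurable]: "(\<lambda>x. norm (f x - s x)) \<in> borel_measurable M"
    "(\<lambda>x. norm (g x - r x)) \<in> borel_measurable M" "q \<in> borel_measurable M"
    using s r by (auto intro!: norm_diff_simple_measurable f g q elim: simple_bochner_integrable.cases)
  have "ennreal (norm (simple_bochner_integral M s - simple_bochner_integral M r)) =
      norm (simple_bochner_integral M (\<lambda>x. s x - r x))"
    using s r by (simp add: simple_bochner_integral_diff)
  also have "\<dots> \<le> simple_bochner_integral M (\<lambda>x. norm (s x - r x))"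
    using simple_bochner_integrable_compose2[of "(-)" M s r] s r
    by (auto intro!: simple_bochner_integral_norm_bound)
  also have "\<dots> = (\<integral>\<^sup>+x. norm (s x - r x) \<partial>M)"
    using simple_bochner_integrable_compose2[of "\<lambda>x y. norm (x - y)" M s r] s r
    by (auto intro!: simple_bochner_integral_eq_nn_integral)
  also have "\<dots> \<le> (\<integral>\<^sup>+x. ennreal (norm (f x - s x)) + ennreal (q x) + ennreal (norm (g x - r x)) \<partial>M)"
  proof (rule nn_integral_mono)
    fix x assume x: "x \<in> space M"
    have q0: "0 \<le> q x" using q(2)[OF x] norm_ge_zero order_trans by blast
    have "s x - r x = - (f x - s x) + ((f x - g x) + (g x - r x))" by simp
    then have "norm (s x - r x) \<le> norm (f x - s x) + (norm (f x - g x) + norm (g x - r x))"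
      by (metis add_left_mono norm_minus_cancel norm_triangle_ineq order_trans)
    also have "\<dots> \<le> norm (f x - s x) + q x + norm (g x - r x)"
      using q(2)[OF x] by simp
    finally show "ennreal (norm (s x - r x)) \<le>
      ennreal (norm (f x - s x)) + ennreal (q x) + ennreal (norm (g x - r x))"
      using q0 by (simp add: ennreal_leI flip: ennreal_plus)
  qed
  also have "\<dots> = (\<integral>\<^sup>+x. norm (f x - s x) \<partial>M) + (\<integral>\<^sup>+x. ennreal (q x) \<partial>M) + (\<integral>\<^sup>+x. norm (g x - r x) \<partial>M)"
    by (simp add: nn_integral_add)
  finally show ?thesis .
qed

text \<open>Simple approximations of \<open>f\<close> and of \<open>g\<close> are compared with each other, so that \<open>f - g\<close>, which may fail to
be measurable, is never integrated. With \<open>g = f\<close> and \<open>q = 0\<close> this gives uniqueness of the integral.\<close>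

lemma has_Bochner_integral_dist_le:
  assumes f: "has_Bochner_integral M f y" and g: "has_Bochner_integral M g w"
    and q: "integrable M q" "\<And>x. x \<in> space M \<Longrightarrow> norm (f x - g x) \<le> q x"
  shows "norm (y - w) \<le> (\<integral>x. q x \<partial>M)"
proof -
  obtain s where fm: "f \<in> borel_measurable M" and s: "\<And>i. simple_bochner_integrable M (s i)"
    "(\<lambda>i. \<integral>\<^sup>+x. ennreal (norm (f x - s i x)) \<partial>M) \<longlonglongrightarrow> 0" "(\<lambda>i. simple_bochner_integral M (s i)) \<longlonglongrightarrow> y"
    using f unfolding has_Bochner_integral_def by blast
  obtain r where gm: "g \<in> borel_measurable M" and r: "\<And>i. simple_bochner_integrable M (r i)"
    "(\<lambda>i. \<integral>\<^sup>+x. ennreal (norm (g x - r i x)) \<partial>M) \<longlonglongrightarrow> 0" "(\<lambda>i. simple_bochner_integral M (r i)) \<longlonglongrightarrow> w"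
    using g unfolding has_Bochner_integral_def by blast
  have "(\<lambda>i. ennreal (norm (simple_bochner_integral M (s i) - simple_bochner_integral M (r i))))
      \<longlonglongrightarrow> ennreal (norm (y - w))"
    by (intro tendsto_intros s(3) r(3))
  moreover have "(\<lambda>i. (\<integral>\<^sup>+x. norm (f x - s i x) \<partial>M) + (\<integral>\<^sup>+x. ennreal (q x) \<partial>M) + (\<integral>\<^sup>+x. norm (g x - r i x) \<partial>M))
      \<longlonglongrightarrow> 0 + (\<integral>\<^sup>+x. ennreal (q x) \<partial>M) + 0"
    by (intro tendsto_add tendsto_const s(2) r(2))
  ultimately have "ennreal (norm (y - w)) \<le> 0 + (\<integral>\<^sup>+x. ennreal (q x) \<partial>M) + 0"
    by (rule LIMSEQ_le) (use simple_bochner_integral_dist_le[OF fm gm _ q(2) s(1) r(1)] q(1) in auto)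
  also have "\<dots> = ennreal (\<integral>x. q x \<partial>M)"
    using nn_integral_eq_integral[OF q(1)] q(2) norm_ge_zero order_trans
    by (smt (verit) AE_I2 add.right_neutral add_0)
  finally show ?thesis
  proof (subst (asm) ennreal_le_iff)
    show "0 \<le> (\<integral>x. q x \<partial>M)"
      using q(2) by (intro Bochner_Integration.integral_nonneg) (meson norm_ge_zero order_trans)
  qed
qed

lemma has_Bochner_integral_unique:
  assumes "has_Bochner_integral M f y" "has_Bochner_integral M f w"
  shows "y = w"
  using has_Bochner_integral_dist_le[OF assms, of "\<lambda>x. 0"] by simp

lemma Bochner_integral_eq:
  assumes "has_Bochner_integral M f y"
  shows "Bochner_integral M f = y"
  using assms has_Bochner_integral_unique unfolding Bochner_integral_def by (auto intro!: the_equality)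

text \<open>The measurability of the sum is a hypothesis because it does not follow from that of the summands when
the space is nonseparable; the functions integrated below are continuous.\<close>

lemma has_Bochner_integral_add:
  assumes f: "has_Bochner_integral M f y" and g: "has_Bochner_integral M g w"
    and fg: "(\<lambda>x. f x + g x) \<in> borel_measurable M"
  shows "has_Bochner_integral M (\<lambda>x. f x + g x) (y + w)"
proof -
  obtain s where fm: "f \<in> borel_measurable M" and s: "\<And>i. simple_bochner_integrable M (s i)"
    "(\<lambda>i. \<integral>\<^sup>+x. ennreal (norm (f x - s i x)) \<partial>M) \<longlonglongrightarrow> 0" "(\<lambda>i. simple_bochner_integral M (s i)) \<longlonglongrightarrow> y"
    using f unfolding has_Bochner_integral_def by blast
  obtain r where gm: "g \<in> borel_measurable M" and r: "\<And>i. simple_bochner_integrable M (r i)"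
    "(\<lambda>i. \<integral>\<^sup>+x. ennreal (norm (g x - r i x)) \<partial>M) \<longlonglongrightarrow> 0" "(\<lambda>i. simple_bochner_integral M (r i)) \<longlonglongrightarrow> w"
    using g unfolding has_Bochner_integral_def by blast
  have [measurable]: "(\<lambda>x. norm (f x - s i x)) \<in> borel_measurable M"
    "(\<lambda>x. norm (g x - r i x)) \<in> borel_measurable M" for i
    using s(1)[of i] r(1)[of i]
    by (auto intro!: norm_diff_simple_measurable fm gm elim: simple_bochner_integrable.cases)
  have "(\<lambda>i. \<integral>\<^sup>+x. ennreal (norm (f x + g x - (s i x + r i x))) \<partial>M) \<longlonglongrightarrow> 0"
  proof (rule tendsto_sandwich[where f="\<lambda>_. 0"])
    show "\<forall>\<^sub>F i in sequentially. (\<integral>\<^sup>+x. ennreal (norm (f x + g x - (s i x + r i x))) \<partial>M) \<le>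
        (\<integral>\<^sup>+x. norm (f x - s i x) \<partial>M) + (\<integral>\<^sup>+x. norm (g x - r i x) \<partial>M)"
    proof (intro always_eventually allI)
      fix i
      have "(\<integral>\<^sup>+x. ennreal (norm (f x + g x - (s i x + r i x))) \<partial>M) \<le>
        (\<integral>\<^sup>+x. ennreal (norm (f x - s i x)) + ennreal (norm (g x - r i x)) \<partial>M)"
        by (auto intro!: nn_integral_mono norm_diff_triangle_ineq simp flip: ennreal_plus)
      also have "\<dots> = (\<integral>\<^sup>+x. norm (f x - s i x) \<partial>M) + (\<integral>\<^sup>+x. norm (g x - r i x) \<partial>M)"
        by (intro nn_integral_add) auto
      finally show "(\<integral>\<^sup>+x. ennreal (norm (f x + g x - (s i x + r i x))) \<partial>M) \<le>
        (\<integral>\<^sup>+x. norm (f x - s i x) \<partial>M) + (\<integral>\<^sup>+x. norm (g x - r i x) \<partial>M)" .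
    qed
    show "(\<lambda>i. (\<integral>\<^sup>+x. norm (f x - s i x) \<partial>M) + (\<integral>\<^sup>+x. norm (g x - r i x) \<partial>M)) \<longlonglongrightarrow> 0"
      using tendsto_add[OF s(2) r(2)] by simp
  qed auto
  moreover have "(\<lambda>i. simple_bochner_integral M (\<lambda>x. s i x + r i x)) \<longlonglongrightarrow> y + w"
    using tendsto_add[OF s(3) r(3)] by (simp add: simple_bochner_integral_add s(1) r(1))
  moreover have "simple_bochner_integrable M (\<lambda>x. s i x + r i x)" for i
    using simple_bochner_integrable_compose2[of "(+)" M "s i" "r i"] s(1) r(1) by simp
  ultimately show ?thesis
    unfolding has_Bochner_integral_def
    by (intro conjI fg exI[of _ "\<lambda>i x. s i x + r i x"]) auto
qed

lemma has_Bochner_integral_scaleR_left: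
  fixes a :: "'a::real_normed_vector"
  assumes "has_bochner_integral M \<phi> (c::real)"
  shows "has_Bochner_integral M (\<lambda>x. \<phi> x *\<^sub>R a) (c *\<^sub>R a)"
  using assms
proof cases
  case (1 s)
  note [measurable] = 1(1)
  have [measurable]: "s i \<in> borel_measurable M" for i
    using 1(2)[of i] by (auto intro: borel_measurable_simple_function elim: simple_bochner_integrable.cases)
  have "(\<lambda>x. \<phi> x *\<^sub>R a) \<in> borel_measurable M"
    by (intro measurable_compose[OF 1(1)] borel_measurable_continuous_onI continuous_intros)
  moreover have "simple_bochner_integrable M (\<lambda>x. s i x *\<^sub>R a)" for i
    using simple_bochner_integrable_compose2[of "\<lambda>u v. u *\<^sub>R a", OF _ 1(2) 1(2)] by simp
  moreover have "(\<lambda>i. \<integral>\<^sup>+x. ennreal (norm (\<phi> x *\<^sub>R a - s i x *\<^sub>R a)) \<partial>M) \<longlonglongrightarrow> 0"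
  proof -
    have "(\<integral>\<^sup>+x. ennreal (norm (\<phi> x *\<^sub>R a - s i x *\<^sub>R a)) \<partial>M) =
        ennreal (norm a) * (\<integral>\<^sup>+x. ennreal (norm (\<phi> x - s i x)) \<partial>M)" for i
      by (subst nn_integral_cmult[symmetric])
        (auto simp: ennreal_mult[symmetric] mult.commute simp flip: scaleR_diff_left)
    then show ?thesis
      using ennreal_tendsto_cmult[OF _ 1(3), of "ennreal (norm a)"] by simp
  qed
  moreover have "(\<lambda>i. simple_bochner_integral M (\<lambda>x. s i x *\<^sub>R a)) \<longlonglongrightarrow> c *\<^sub>R a"
  proof -
    have "linear (\<lambda>u::real. u *\<^sub>R a)"
      by (rule bounded_linear.linear[OF bounded_linear_scaleR_left])
    from simple_bochner_integral_linear[OF this 1(2)] show ?thesis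
      using 1(4) by (auto intro!: tendsto_intros)
  qed
  ultimately show ?thesis
    unfolding has_Bochner_integral_def
    by (intro conjI exI[of _ "\<lambda>i x. s i x *\<^sub>R a"]) auto
qed

lemma has_Bochner_integral_sum_scaleR:
  fixes a :: "nat \<Rightarrow> 'a::real_normed_vector"
  assumes \<phi>: "\<And>i. i < p \<Longrightarrow> has_bochner_integral M (\<phi> i) (c i :: real)"
    and meas: "\<And>q. q \<le> p \<Longrightarrow> (\<lambda>x. \<Sum>i<q. \<phi> i x *\<^sub>R a i) \<in> borel_measurable M"
  shows "has_Bochner_integral M (\<lambda>x. \<Sum>i<p. \<phi> i x *\<^sub>R a i) (\<Sum>i<p. c i *\<^sub>R a i)"
  using assms
proof (induction p)
  case 0
  have "has_Bochner_integral M (\<lambda>x. 0 *\<^sub>R (0::'a)) (0 *\<^sub>R 0)"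
    by (rule has_Bochner_integral_scaleR_left) (rule has_bochner_integral_zero)
  then show ?case by simp
next
  case (Suc p)
  then show ?case
    using Suc.prems(2)[of "Suc p"]
    by (auto intro!: has_Bochner_integral_add has_Bochner_integral_scaleR_left)
qed

lemma has_Bochner_integral_exists_limit:
  fixes f :: "'b \<Rightarrow> 'a::banach"
  assumes f: "f \<in> borel_measurable M" and s: "\<And>i. simple_bochner_integrable M (s i)"
    and lim: "(\<lambda>i. \<integral>\<^sup>+x. ennreal (norm (f x - s i x)) \<partial>M) \<longlonglongrightarrow> 0"
  shows "\<exists>y. has_Bochner_integral M f y"
proof -
  have "Cauchy (\<lambda>i. simple_bochner_integral M (s i))"
  proof (rule metric_CauchyI)
    fix e :: real assume e: "e > 0"
    have "\<forall>\<^sub>F i in sequentially. (\<integral>\<^sup>+x. ennreal (norm (f x - s i x)) \<partial>M) < ennreal (e / 3)"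
      using lim by (rule order_tendstoD) (use e in simp)
    then obtain N where N: "\<And>i. i \<ge> N \<Longrightarrow> (\<integral>\<^sup>+x. ennreal (norm (f x - s i x)) \<partial>M) < ennreal (e / 3)"
      unfolding eventually_sequentially by blast
    show "\<exists>N. \<forall>i\<ge>N. \<forall>j\<ge>N. dist (simple_bochner_integral M (s i)) (simple_bochner_integral M (s j)) < e"
    proof (intro exI[of _ N] allI impI)
      fix i j assume ij: "i \<ge> N" "j \<ge> N"
      have "ennreal (norm (simple_bochner_integral M (s i) - simple_bochner_integral M (s j))) \<le>
          (\<integral>\<^sup>+x. norm (f x - s i x) \<partial>M) + (\<integral>\<^sup>+x. norm (f x - s j x) \<partial>M)"
        using simple_bochner_integral_dist_le[OF f f _ _ s s, of "\<lambda>x. 0" i j] by simp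
      also have "\<dots> \<le> ennreal (e / 3) + ennreal (e / 3)"
        by (intro add_mono less_imp_le N ij)
      also have "\<dots> < ennreal e"
        using e by (simp add: ennreal_less_iff flip: ennreal_plus)
      finally show "dist (simple_bochner_integral M (s i)) (simple_bochner_integral M (s j)) < e"
        using e by (simp add: dist_norm ennreal_less_iff)
    qed
  qed
  then obtain y where "(\<lambda>i. simple_bochner_integral M (s i)) \<longlonglongrightarrow> y"
    using Cauchy_convergent_iff convergent_def by blast
  then show ?thesis
    unfolding has_Bochner_integral_def using f s lim by blast
qed

text \<open>The approximating simple functions sample \<open>f\<close> on the grid of mesh \<open>1/(i+1)\<close> in the interval
\<open>[0, i+1]\<close> and are constant beyond it. They are uniformly bounded, so dominated convergence applies.\<close>

lemma has_Bochner_integral_bounded_continuous: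
  fixes f :: "real \<Rightarrow> 'a::banach"
  assumes sets: "sets M = sets (restrict_space borel {0..})" and fin: "emeasure M (space M) < \<infinity>"
    and cont: "continuous_on {0..} f" and bound: "\<And>x. x \<ge> 0 \<Longrightarrow> norm (f x) \<le> K"
  shows "\<exists>y. has_Bochner_integral M f y"
proof -
  have space: "space M = {0..}"
    using sets_eq_imp_space_eq[OF sets] by (simp add: space_restrict_space)
  have meas: "g \<in> borel_measurable M" if "continuous_on {0..} g" for g :: "real \<Rightarrow> 'c::topological_space"
    using borel_measurable_continuous_on_restrict[OF that] sets by (simp cong: measurable_cong_sets)
  have [measurable]: "(\<lambda>x. x) \<in> borel_measurable M"
    by (rule meas) (rule continuous_on_id)
  have f: "f \<in> borel_measurable M" by (rule meas[OF cont])
  define k where "k i x = min (nat \<lfloor>real (Suc i) * x\<rfloor>) (Suc i * Suc i)" for i x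
  define s where "s i x = f (real (k i x) / real (Suc i))" for i x
  have simple: "simple_function M (s i)" for i
  proof -
    have "simple_function M (k i)"
      unfolding simple_function_def
    proof (intro conjI ballI)
      show "finite (k i ` space M)"
        by (rule finite_subset[of _ "{..Suc i * Suc i}"]) (auto simp: k_def)
      have "k i \<in> measurable M (count_space UNIV)"
        unfolding k_def by measurable
      then show "k i -` {n} \<inter> space M \<in> sets M" for n
        by (rule measurable_sets) simp
    qed
    from simple_function_compose1[OF this, of "\<lambda>k. f (real k / real (Suc i))"]
    show ?thesis by (simp add: s_def[abs_def])
  qed
  have s: "simple_bochner_integrable M (s i)" for i
  proof
    have "emeasure M {x \<in> space M. s i x \<noteq> 0} \<le> emeasure M (space M)"
      by (rule emeasure_space)
    then show "emeasure M {x \<in> space M. s i x \<noteq> 0} \<noteq> \<infinity>"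
      using fin by auto
  qed (rule simple)
  have pointwise: "(\<lambda>i. s i x) \<longlonglongrightarrow> f x" if x: "x \<ge> 0" for x
  proof -
    have "(\<lambda>i. real (k i x) / real (Suc i)) \<longlonglongrightarrow> x"
    proof (rule LIMSEQ_offset)
      define N where "N = nat \<lceil>x\<rceil>"
      have bounds: "x - 1 / real (Suc i) \<le> real (k i x) / real (Suc i)"
         "real (k i x) / real (Suc i) \<le> x" if "i \<ge> N" for i
      proof -
        have "x \<le> real (Suc i)" using that x unfolding N_def by linarith
        then have "real (Suc i) * x \<le> real (Suc i * Suc i)" 
          using mult_left_mono[of x "real (Suc i)" "real (Suc i)"] by (simp only: of_nat_mult of_nat_0_le_iff)
        then have "nat \<lfloor>real (Suc i) * x\<rfloor> \<le> Suc i * Suc i" by linarith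
        then have k: "k i x = nat \<lfloor>real (Suc i) * x\<rfloor>" by (simp add: k_def)
        have "0 \<le> real (Suc i) * x" using x by simp
        then have "real (Suc i) * x - 1 \<le> real (k i x)" "real (k i x) \<le> real (Suc i) * x"
          unfolding k by linarith+
        then have "(real (Suc i) * x - 1) / real (Suc i) \<le> real (k i x) / real (Suc i)"
          "real (k i x) / real (Suc i) \<le> real (Suc i) * x / real (Suc i)"
          by (intro divide_right_mono; simp)+
        then show "x - 1 / real (Suc i) \<le> real (k i x) / real (Suc i)"
          "real (k i x) / real (Suc i) \<le> x"
          by (simp_all only: diff_divide_distrib nonzero_mult_div_cancel_left of_nat_eq_0_iff nat.distinct not_False_eq_True)
      qed
      have "(\<lambda>i. x - 1 / real (Suc i)) \<longlonglongrightarrow> x - 0"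
        by (intro tendsto_diff tendsto_const LIMSEQ_Suc[OF lim_1_over_n])
      then have lim: "(\<lambda>i. x - 1 / real (Suc (i + N))) \<longlonglongrightarrow> x"
        using LIMSEQ_ignore_initial_segment[of "\<lambda>i. x - 1 / real (Suc i)" x N] by simp
      show "(\<lambda>i. real (k (i + N) x) / real (Suc (i + N))) \<longlonglongrightarrow> x"
        by (rule tendsto_sandwich[OF _ _ lim tendsto_const]; intro always_eventually allI bounds le_add2)
    qed
    then show ?thesis
      unfolding s_def using cont x by (intro continuous_on_tendsto_compose[OF cont]) auto
  qed
  have "(\<lambda>i. \<integral>\<^sup>+x. ennreal (norm (f x - s i x)) \<partial>M) \<longlonglongrightarrow> (\<integral>\<^sup>+x. 0 \<partial>M)"
  proof (rule nn_integral_dominated_convergence[where w="\<lambda>_. ennreal (2 * K)"])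
    show "(\<lambda>x. ennreal (norm (f x - s i x))) \<in> borel_measurable M" for i
      using norm_diff_simple_measurable[OF f simple] by measurable
    have "norm (f x - s i x) \<le> 2 * K" if "x \<ge> 0" for x i
      using norm_triangle_ineq4[of "f x" "s i x"] bound[OF that] bound[of "real (k i x) / real (Suc i)"]
      unfolding s_def by simp
    then show "AE x in M. ennreal (norm (f x - s i x)) \<le> ennreal (2 * K)" for i
      using space by (intro AE_I2 ennreal_leI) auto
    show "AE x in M. (\<lambda>i. ennreal (norm (f x - s i x))) \<longlonglongrightarrow> 0"
    proof (rule AE_I2)
      fix x assume "x \<in> space M"
      then have "(\<lambda>i. ennreal (norm (f x - s i x))) \<longlonglongrightarrow> ennreal (norm (f x - f x))"
        using space by (intro tendsto_ennrealI tendsto_norm tendsto_diff tendsto_const pointwise) auto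
      then show "(\<lambda>i. ennreal (norm (f x - s i x))) \<longlonglongrightarrow> 0" by simp
    qed
    show "(\<integral>\<^sup>+x. ennreal (2 * K) \<partial>M) < \<infinity>"
      using fin by (simp add: ennreal_mult_less_top)
  qed auto
  then show ?thesis
    by (intro has_Bochner_integral_exists_limit[OF f s]) simp
qed

section \<open>Taylor expansion of the orbits\<close>

lemma Taylor_norm_bound:
  fixes E :: "nat \<Rightarrow> real \<Rightarrow> 'a::banach"
  assumes p: "p > 0" and ab: "a \<le> b"
    and E: "\<And>m v. m < p \<Longrightarrow> v \<in> {a..b} \<Longrightarrow> (E m has_vector_derivative E (Suc m) v) (at v within {a..b})"
    and K: "\<And>v. v \<in> {a..b} \<Longrightarrow> norm (E p v) \<le> K"
  shows "norm (E 0 b - (\<Sum>i<p. ((b - a) ^ i / fact i) *\<^sub>R E i a)) \<le> K * (b - a) ^ p / fact p"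
proof -
  obtain q where q: "p = Suc q" using p gr0_conv_Suc by blast
  let ?i = "\<lambda>v. ((b - v) ^ (p - 1) / fact (p - 1)) *\<^sub>R E p v"
  have int: "?i integrable_on {a..b}"
    and taylor: "E 0 b - (\<Sum>i<p. ((b - a) ^ i / fact i) *\<^sub>R E i a) = integral {a..b} ?i"
    using Taylor_integrable[of p E "E 0" a b] Taylor_integral[of p E "E 0" a b] p ab E by auto
  have bound: "((\<lambda>v. K * ((b - v) ^ (p - 1) / fact (p - 1))) has_integral K * ((b - a) ^ p / fact p)) {a..b}"
  proof -
    have "((\<lambda>v. - ((b - v) ^ p / fact p)) has_vector_derivative (b - v) ^ (p - 1) / fact (p - 1))
      (at v within {a..b})" for v
    proof -
      have "((\<lambda>v. (b - v) ^ Suc q) has_real_derivative - (real (Suc q) * (b - v) ^ q)) (at v within {a..b})"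
        by (auto intro!: derivative_eq_intros simp del: power_Suc)
      from DERIV_cmult[OF this, of "- 1 / fact (Suc q)"]
      have "((\<lambda>v. - ((b - v) ^ Suc q / fact (Suc q))) has_real_derivative
          - 1 / fact (Suc q) * - (real (Suc q) * (b - v) ^ q)) (at v within {a..b})"
        by simp
      also have "- 1 / fact (Suc q) * - (real (Suc q) * (b - v) ^ q) = (b - v) ^ q / fact q"
        by (simp only: fact_Suc) (simp add: divide_simps)
      finally show ?thesis
        unfolding has_real_derivative_iff_has_vector_derivative[symmetric] q by simp
    qed
    from fundamental_theorem_of_calculus[OF ab this]
    have "((\<lambda>v. (b - v) ^ (p - 1) / fact (p - 1)) has_integral (b - a) ^ p / fact p) {a..b}"
      by (simp add: q)
    then show ?thesis by (rule has_integral_mult_right)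
  qed
  have "norm (integral {a..b} ?i) \<le> integral {a..b} (\<lambda>v. K * ((b - v) ^ (p - 1) / fact (p - 1)))"
  proof (rule integral_norm_bound_integral[OF int])
    show "(\<lambda>v. K * ((b - v) ^ (p - 1) / fact (p - 1))) integrable_on {a..b}"
      using bound by blast
    fix v assume v: "v \<in> {a..b}"
    then have "norm (E p v) * ((b - v) ^ (p - 1) / fact (p - 1)) \<le> K * ((b - v) ^ (p - 1) / fact (p - 1))"
      by (intro mult_right_mono K) auto
    then show "norm (?i v) \<le> K * ((b - v) ^ (p - 1) / fact (p - 1))"
      using v by (simp add: mult.commute)
  qed
  also have "\<dots> = K * ((b - a) ^ p / fact p)"
    using bound by (rule integral_unique)
  finally show ?thesis
    unfolding taylor by simp
qed

text \<open>The case \<open>s < t\<close> reduces to the other one by reflecting the interval at its midpoint.\<close>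

lemma Taylor_norm_bound_two_sided:
  fixes E :: "nat \<Rightarrow> real \<Rightarrow> 'a::banach"
  assumes p: "p > 0" and s: "s \<ge> 0" and t: "t \<ge> 0"
    and E: "\<And>m v. m < p \<Longrightarrow> v \<ge> 0 \<Longrightarrow> (E m has_vector_derivative E (Suc m) v) (at v within {0..})"
    and K: "\<And>v. v \<ge> 0 \<Longrightarrow> norm (E p v) \<le> K"
  shows "norm (E 0 s - (\<Sum>i<p. ((s - t) ^ i / fact i) *\<^sub>R E i t)) \<le> K * \<bar>s - t\<bar> ^ p / fact p"
proof (cases "t \<le> s")
  case True
  have "norm (E 0 s - (\<Sum>i<p. ((s - t) ^ i / fact i) *\<^sub>R E i t)) \<le> K * (s - t) ^ p / fact p"
    using t by (intro Taylor_norm_bound p True K) (auto intro: has_vector_derivative_within_subset[OF E])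
  then show ?thesis using True by simp
next
  case False
  define F where "F k v = (- 1) ^ k *\<^sub>R E k (s + t - v)" for k v
  have F: "(F m has_vector_derivative F (Suc m) v) (at v within {s..t})" if "m < p" "v \<in> {s..t}" for m v
  proof -
    have 1: "((\<lambda>v. s + t - v) has_vector_derivative (- 1)) (at v within {s..t})"
      by (auto intro!: derivative_eq_intros)
    have "(E m has_vector_derivative E (Suc m) (s + t - v)) (at (s + t - v) within (\<lambda>v. s + t - v) ` {s..t})"
      using that s by (intro has_vector_derivative_within_subset[OF E]) auto
    from vector_diff_chain_within[OF 1 this]
    have "((\<lambda>v. E m (s + t - v)) has_vector_derivative (- 1) *\<^sub>R E (Suc m) (s + t - v)) (at v within {s..t})"
      by (simp add: comp_def)
    then have "(F m has_vector_derivative (- 1) ^ m *\<^sub>R ((- 1) *\<^sub>R E (Suc m) (s + t - v))) (at v within {s..t})"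
      unfolding F_def
      by (rule bounded_linear.has_vector_derivative[OF bounded_linear_scaleR_right])
    then show ?thesis by (simp add: F_def)
  qed
  have "norm (F p v) \<le> K" if "v \<in> {s..t}" for v
    using K[of "s + t - v"] that s by (simp add: F_def)
  then have "norm (F 0 t - (\<Sum>i<p. ((t - s) ^ i / fact i) *\<^sub>R F i s)) \<le> K * (t - s) ^ p / fact p"
    using False by (intro Taylor_norm_bound p F) auto
  moreover have "((t - s) ^ i / fact i) *\<^sub>R F i s = ((s - t) ^ i / fact i) *\<^sub>R E i t" for i
  proof -
    have "(t - s) ^ i * (- 1) ^ i = (s - t) ^ i"
      by (simp flip: power_mult_distrib)
    then show ?thesis by (simp add: F_def)
  qed
  ultimately show ?thesis
    using False by (simp only:) (simp add: F_def)
qed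

locale bounded_semigroup =
  fixes T :: "real \<Rightarrow> 'a::complex_banach \<Rightarrow> 'a"
  assumes semigroup: "bounded_C0_semigroup T"
begin

definition bound :: real where "bound = (SUP t\<in>{0..}. onorm (T t))"

lemma bounded_linear_T: "t \<ge> 0 \<Longrightarrow> bounded_linear (T t)"
  using semigroup unfolding bounded_C0_semigroup_def by blast

lemma T_add: "s \<ge> 0 \<Longrightarrow> t \<ge> 0 \<Longrightarrow> T (s + t) x = T s (T t x)"
  using semigroup unfolding bounded_C0_semigroup_def by blast

lemma T_at_right_0: "((\<lambda>t. T t x) \<longlongrightarrow> x) (at_right 0)"
  using semigroup unfolding bounded_C0_semigroup_def by blast

lemma norm_T_le: 
  assumes "t \<ge> 0" shows "norm (T t x) \<le> bound * norm x"
proof -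
  obtain K where K: "\<And>t. t \<ge> 0 \<Longrightarrow> onorm (T t) \<le> K"
    using semigroup unfolding bounded_C0_semigroup_def by blast
  have "onorm (T t) \<le> bound"
    unfolding bound_def using assms K by (intro cSUP_upper bdd_aboveI[of _ K]) auto
  then have "onorm (T t) * norm x \<le> bound * norm x"
    by (intro mult_right_mono) auto
  with onorm[OF bounded_linear_T[OF assms], of x] show ?thesis by linarith
qed

lemma bound_nonneg: "bound \<ge> 0"
proof -
  obtain K where K: "\<And>t. t \<ge> 0 \<Longrightarrow> onorm (T t) \<le> K"
    using semigroup unfolding bounded_C0_semigroup_def by blast
  have "onorm (T 0) \<le> bound"
    unfolding bound_def using K by (intro cSUP_upper bdd_aboveI[of _ K]) auto
  then show ?thesis
    using onorm_pos_le[OF bounded_linear_T[of 0]] by simp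
qed

lemma T_diff: "0 \<le> s \<Longrightarrow> 0 \<le> h \<Longrightarrow> T (s + h) x - T s x = T s (T h x - x)"
  using linear_diff[OF bounded_linear.linear[OF bounded_linear_T]] by (simp add: T_add)

text \<open>The operator at the smaller of the two times factors out, which reduces every continuity and
differentiability question to the time \<open>0\<close>.\<close>

lemma norm_T_diff_le:
  assumes "0 \<le> s" "0 \<le> t"
  shows "norm (T s x - T t x) \<le> bound * norm (T \<bar>s - t\<bar> x - x)"
proof -
  have *: "norm (T b x - T a x) \<le> bound * norm (T (b - a) x - x)" if "0 \<le> a" "a \<le> b" for a b
    using T_diff[of a "b - a" x] norm_T_le[of a "T (b - a) x - x"] that by simp
  show ?thesis
    using *[of s t] *[of t s] assms by (cases "s \<le> t") (auto simp: norm_minus_commute)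
qed

lemma filterlim_abs_diff_at_right_0: "filterlim (\<lambda>u. \<bar>u - s\<bar>) (at_right 0) (at s within S)"
  for s :: real
proof -
  have "((\<lambda>u. \<bar>u - s\<bar>) \<longlongrightarrow> \<bar>s - s\<bar>) (at s within S)"
    by (intro tendsto_intros)
  then show ?thesis
    unfolding filterlim_at by (auto simp: eventually_at_filter)
qed

lemma T_tendsto: 
  assumes s: "s \<ge> 0" shows "((\<lambda>u. T u x) \<longlongrightarrow> T s x) (at s within {0..})"
proof -
  have "((\<lambda>h. bound * norm (T h x - x)) \<longlongrightarrow> bound * norm (x - x)) (at_right 0)"
    by (intro tendsto_intros T_at_right_0)
  from filterlim_compose[OF this filterlim_abs_diff_at_right_0]
  have lim: "((\<lambda>u. bound * norm (T \<bar>u - s\<bar> x - x)) \<longlongrightarrow> 0) (at s within {0..})"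
    by simp
  have "((\<lambda>u. T u x - T s x) \<longlongrightarrow> 0) (at s within {0..})"
    by (rule Lim_null_comparison[OF _ lim])
      (use norm_T_diff_le s in \<open>auto simp: eventually_at_filter\<close>)
  then show ?thesis by (simp add: LIM_zero_iff)
qed

lemma continuous_on_T: "continuous_on {0..} (\<lambda>s. T s x)"
  unfolding continuous_on_def using T_tendsto by auto

text \<open>The generator is defined by a one-sided limit. Factoring out the operator at time \<open>min u s\<close> turns the
difference quotients from either side into the one at \<open>0\<close>; for \<open>u < s\<close> that operator varies with \<open>u\<close>, which
is compensated by strong continuity.\<close>

lemma has_vector_derivative_T:
  assumes gen: "((\<lambda>h. (T h x - x) /\<^sub>R h) \<longlongrightarrow> y) (at_right 0)" and s: "s \<ge> 0"
  shows "((\<lambda>u. T u x) has_vector_derivative T s y) (at s within {0..})"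
  unfolding has_vector_derivative_def
proof (rule has_derivativeI_sandwich[where e=1])
  let ?q = "\<lambda>h. (T h x - x) /\<^sub>R h"
  let ?H = "\<lambda>u. bound * norm (?q \<bar>u - s\<bar> - y) + norm (T (min u s) y - T s y)"
  show "bounded_linear (\<lambda>h. h *\<^sub>R T s y)"
    by (rule bounded_linear_scaleR_left)
  show "norm (T u x - T s x - (u - s) *\<^sub>R T s y) / norm (u - s) \<le> ?H u"
    if "u \<in> {0..}" "u \<noteq> s" for u
  proof -
    define h where "h = \<bar>u - s\<bar>"
    define m where "m = min u s"
    have h: "h > 0" and m: "m \<ge> 0" using that s by (auto simp: h_def m_def)
    interpret Tm: bounded_linear "T m" by (rule bounded_linear_T[OF m])
    have "T (m + h) x - T m x = h *\<^sub>R T m (?q h)"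
      using T_diff[OF m, of h x] h by (simp add: Tm.scaleR)
    moreover have "norm (T u x - T s x - (u - s) *\<^sub>R T s y) = norm (T (m + h) x - T m x - h *\<^sub>R T s y)"
    proof (cases "s \<le> u")
      case False
      then have *: "m = u" "m + h = s" "u - s = - h" by (auto simp: m_def h_def)
      have "T u x - T s x - (u - s) *\<^sub>R T s y = - (T (m + h) x - T m x - h *\<^sub>R T s y)"
        unfolding *(2,3) by (simp add: *(1))
      then show ?thesis by (simp only: norm_minus_cancel)
    qed (use that in \<open>auto simp: m_def h_def\<close>)
    moreover have "h *\<^sub>R T m (?q h) - h *\<^sub>R T s y = h *\<^sub>R (T m (?q h - y) + (T m y - T s y))"
      unfolding Tm.diff by (simp add: scaleR_diff_right scaleR_add_right)
    ultimately have "norm (T u x - T s x - (u - s) *\<^sub>R T s y) = norm (h *\<^sub>R (T m (?q h - y) + (T m y - T s y)))"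
      by (simp only:)
    also have "\<dots> \<le> h * (norm (T m (?q h - y)) + norm (T m y - T s y))"
      using h by (simp add: mult_left_mono norm_triangle_ineq del: inverse_eq_divide)
    also have "\<dots> \<le> h * ?H u"
      using h norm_T_le[OF m, of "?q h - y"] by (intro mult_left_mono) (auto simp: h_def m_def)
    finally show ?thesis
      using h by (simp add: h_def[symmetric] pos_divide_le_eq mult.commute)
  qed
  have "((\<lambda>h. bound * norm (?q h - y)) \<longlongrightarrow> bound * norm (y - y)) (at_right 0)"
    by (intro tendsto_intros gen)
  from filterlim_compose[OF this filterlim_abs_diff_at_right_0]
  have 1: "((\<lambda>u. bound * norm (?q \<bar>u - s\<bar> - y)) \<longlongrightarrow> 0) (at s within {0..})"
    by simp
  have "continuous_on {0..} (\<lambda>u. T (min u s) y)"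
    using s by (intro continuous_on_compose2[OF continuous_on_T] continuous_intros) auto
  then have "((\<lambda>u. T (min u s) y) \<longlongrightarrow> T (min s s) y) (at s within {0..})"
    using s unfolding continuous_on_def by blast
  then have "((\<lambda>u. norm (T (min u s) y - T s y)) \<longlongrightarrow> norm (T s y - T s y)) (at s within {0..})"
    by (intro tendsto_intros) simp
  with 1 show "(?H \<longlongrightarrow> 0) (at s within {0..})"
    using tendsto_add[OF 1] by fastforce
qed simp

lemma norm_Taylor_T_le:
  assumes gen: "is_generator D (\<lambda>x. - A x) T" and x: "x \<in> dom_power D A p" and p: "p > 0"
    and s: "s \<ge> 0" and t: "t \<ge> 0"
  shows "norm (T s x - (\<Sum>i<p. (s - t) ^ i *\<^sub>R (((- 1) ^ i / fact i) *\<^sub>R T t ((A ^^ i) x))))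
     \<le> bound * \<bar>s - t\<bar> ^ p / fact p * norm ((A ^^ p) x)"
proof -
  define E where "E k v = (- 1) ^ k *\<^sub>R T v ((A ^^ k) x)" for k v
  have dom: "(A ^^ k) x \<in> D" if "k < p" for k
    using x that by (induction p) (auto simp: less_Suc_eq)
  have E: "(E m has_vector_derivative E (Suc m) v) (at v within {0..})" if "m < p" "v \<ge> 0" for m v
  proof -
    have "((\<lambda>h. (T h ((A ^^ m) x) - (A ^^ m) x) /\<^sub>R h) \<longlongrightarrow> - A ((A ^^ m) x)) (at_right 0)"
      using gen dom[OF that(1)] unfolding is_generator_def by blast
    from bounded_linear.has_vector_derivative[OF bounded_linear_scaleR_right
        has_vector_derivative_T[OF this that(2)], of "(- 1) ^ m"]
    show ?thesis
      using linear_neg[OF bounded_linear.linear[OF bounded_linear_T[OF that(2)]]]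
      by (simp add: E_def[abs_def])
  qed
  have "norm (E p v) \<le> bound * norm ((A ^^ p) x)" if "v \<ge> 0" for v
    using norm_T_le[OF that] by (simp add: E_def)
  from Taylor_norm_bound_two_sided[OF p s t E this]
  have "norm (E 0 s - (\<Sum>i<p. ((s - t) ^ i / fact i) *\<^sub>R E i t))
     \<le> bound * norm ((A ^^ p) x) * \<bar>s - t\<bar> ^ p / fact p"
    by auto
  then show ?thesis by (simp add: E_def ac_simps)
qed

end

section \<open>The approximation estimates\<close>

context bounded_semigroup
begin

text \<open>The Taylor polynomial of the orbit at \<open>t\<close> integrates to a combination of the central moments \<open>C i\<close>, and
its error bound to the absolute moment of order \<open>p\<close>.\<close>

lemma hille_phillips_Taylor:
  assumes gen: "is_generator D (\<lambda>x. - A x) T" and x: "x \<in> dom_power D A p" and p: "p > 0"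
    and t: "t \<ge> 0" and rep: "represents (representing_measure h) h"
    and C: "\<And>k. k < p \<Longrightarrow> has_bochner_integral (representing_measure h) (\<lambda>s. (s - t) ^ k) (C k)"
    and B: "integrable (representing_measure h) (\<lambda>s. \<bar>s - t\<bar> ^ p)"
  shows "norm (hille_phillips T h x - (\<Sum>i<p. C i *\<^sub>R (((- 1) ^ i / fact i) *\<^sub>R T t ((A ^^ i) x))))
    \<le> bound * (\<integral>s. \<bar>s - t\<bar> ^ p \<partial>representing_measure h) / fact p * norm ((A ^^ p) x)"
proof -
  let ?\<nu> = "representing_measure h"
  let ?a = "\<lambda>i. ((- 1) ^ i / fact i) *\<^sub>R T t ((A ^^ i) x)"
  have space: "space ?\<nu> = {0..}" by (rule represents_space[OF rep])
  have "integrable ?\<nu> (\<lambda>s. 1 :: real)"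
    using C[OF p] by (simp add: has_bochner_integral_iff)
  then have fin: "emeasure ?\<nu> (space ?\<nu>) < \<infinity>"
    unfolding integrable_iff_bounded by simp
  have "\<exists>y. has_Bochner_integral ?\<nu> (\<lambda>s. T s x) y"
    using rep unfolding represents_def
    by (intro has_Bochner_integral_bounded_continuous[where K="bound * norm x", OF _ fin continuous_on_T])
      (auto intro: norm_T_le)
  then have f: "has_Bochner_integral ?\<nu> (\<lambda>s. T s x) (hille_phillips T h x)"
    unfolding hille_phillips_def using Bochner_integral_eq by metis
  have g: "has_Bochner_integral ?\<nu> (\<lambda>s. \<Sum>i<p. (s - t) ^ i *\<^sub>R ?a i) (\<Sum>i<p. C i *\<^sub>R ?a i)"
    by (intro has_Bochner_integral_sum_scaleR C represents_measurable[OF rep] continuous_intros)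
  have "norm (hille_phillips T h x - (\<Sum>i<p. C i *\<^sub>R ?a i)) \<le>
      (\<integral>s. bound / fact p * norm ((A ^^ p) x) * \<bar>s - t\<bar> ^ p \<partial>?\<nu>)"
  proof (rule has_Bochner_integral_dist_le[OF f g])
    fix s assume "s \<in> space ?\<nu>"
    then show "norm (T s x - (\<Sum>i<p. (s - t) ^ i *\<^sub>R ?a i)) \<le> bound / fact p * norm ((A ^^ p) x) * \<bar>s - t\<bar> ^ p"
      using norm_Taylor_T_le[OF gen x p _ t, of s] space by (simp add: ac_simps)
  qed (use B in simp)
  then show ?thesis by (simp add: ac_simps)
qed

end

theorem theorem1p2:
  fixes T :: "real \<Rightarrow> 'a::complex_banach \<Rightarrow> 'a"
    and A :: "'a \<Rightarrow> 'a" and D :: "'a set"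
    and g :: "real \<Rightarrow> real \<Rightarrow> real" and M :: real
  assumes semigroup: "bounded_C0_semigroup T"
    and generator: "is_generator D (\<lambda>x. - A x) T"
    and cm: "\<And>t. t > 0 \<Longrightarrow> completely_monotone (g t)"
    and g0: "\<And>t. t > 0 \<Longrightarrow> deriv_at_0 0 (g t) = 1"
    and g1: "\<And>t. t > 0 \<Longrightarrow> deriv_at_0 1 (g t) = - 1"
    and g2: "\<And>t. t > 0 \<Longrightarrow> deriv_at_0 2 (g t) < \<infinity>"
    and g3: "\<And>t. t > 0 \<Longrightarrow> \<bar>deriv_at_0 3 (g t)\<bar> < \<infinity>"
    and g4: "\<And>t. t > 0 \<Longrightarrow> deriv_at_0 4 (g t) < \<infinity>"
    and M: "M = (SUP t\<in>{0..}. onorm (T t))"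
  shows "(\<forall>t>0. \<forall>n\<ge>1. \<forall>x\<in>dom_power D A 3.
            norm (hille_phillips T (\<lambda>z. g t (t * z / real n) ^ n) x - T t x
                  - (inverse (2 * real n) * (real_of_ereal (deriv_at_0 2 (g t)) - 1) * t ^ 2)
                      *\<^sub>R T t ((A ^^ 2) x))
            \<le> M * C_const (g t) * t ^ 3 * real n powr (- 3 / 2) * norm ((A ^^ 3) x)) \<and>
         (\<forall>t>0. \<forall>n\<ge>1. \<forall>x\<in>dom_power D A 4.
            norm (hille_phillips T (\<lambda>z. g t (t * z / real n) ^ n) x - T t x
                  - (inverse (2 * real n) * (real_of_ereal (deriv_at_0 2 (g t)) - 1) * t ^ 2)
                      *\<^sub>R T t ((A ^^ 2) x))
            \<le> M * C1_const (g t) * inverse (real n ^ 2) * t ^ 3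
                * (norm ((A ^^ 3) x) + t * norm ((A ^^ 4) x)))"
proof -
  interpret bounded_semigroup T by unfold_locales (rule semigroup)
  have M: "M = bound" unfolding M bound_def ..
  have jet: "has_jet 4 (g t) (\<lambda>k. real_of_ereal (deriv_at_0 k (g t)))" if t: "t > 0" for t
  proof (rule has_jet_deriv_at_0[OF cm[OF t]])
    fix k :: nat assume "k \<le> 4"
    then show "\<bar>deriv_at_0 k (g t)\<bar> \<noteq> \<infinity>"
    proof (rule le_4_cases)
      assume k: "k = 0" show ?thesis unfolding k g0[OF t] by simp
    next
      assume k: "k = 1" show ?thesis unfolding k g1[OF t] by simp
    next
      assume k: "k = 2"
      show ?thesis unfolding k using g2[OF t] deriv_at_0_nonneg[OF cm[OF t], of 2] by auto
    next
      assume k: "k = 3" show ?thesis unfolding k using g3[OF t] by auto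
    next
      assume k: "k = 4"
      show ?thesis unfolding k using g4[OF t] deriv_at_0_nonneg[OF cm[OF t], of 4] by auto
    qed
  qed
  have "norm (hille_phillips T (\<lambda>z. g t (t * z / real n) ^ n) x - T t x
          - (inverse (2 * real n) * (real_of_ereal (deriv_at_0 2 (g t)) - 1) * t ^ 2) *\<^sub>R T t ((A ^^ 2) x))
        \<le> M * C_const (g t) * t ^ 3 * real n powr (- 3 / 2) * norm ((A ^^ 3) x)" (is "?bound3 t n x")
    and "x \<in> dom_power D A 4 \<Longrightarrow>
        norm (hille_phillips T (\<lambda>z. g t (t * z / real n) ^ n) x - T t x
          - (inverse (2 * real n) * (real_of_ereal (deriv_at_0 2 (g t)) - 1) * t ^ 2) *\<^sub>R T t ((A ^^ 2) x))
        \<le> M * C1_const (g t) * inverse (real n ^ 2) * t ^ 3 * (norm ((A ^^ 3) x) + t * norm ((A ^^ 4) x))"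
    if t: "t > 0" and n: "n \<ge> 1" and x: "x \<in> dom_power D A 3" for t n x
  proof -
    define a where "a k = real_of_ereal (deriv_at_0 k (g t))" for k
    define h where "h = (\<lambda>z. g t (t * z / real n) ^ n)"
    define c2 where "c2 = a 2 - 1"
    define c3 where "c3 = a 3 + 3 * a 2 - 2"
    define c4 where "c4 = a 4 + 4 * a 3 + 6 * a 2 - 3"
    define Q where "Q = a 4 - 1"
    define C where "C k = (if k = 0 then 1 else if k = 1 then 0 else if k = 2 then t\<^sup>2 * c2 / n
       else if k = 3 then - (t ^ 3 * c3 / (real n)\<^sup>2)
       else t ^ 4 * (c4 + 3 * (real n - 1) * c2\<^sup>2) / real n ^ 3)" for k :: nat
    have a01: "a 0 = 1" "a 1 = - 1" using g0[OF t] g1[OF t] by (simp_all add: a_def)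
    have ajet: "has_jet 4 (g t) a" using jet[OF t] by (simp add: a_def[abs_def])
    have n0: "real n \<ge> 1" using n by simp
    note bounds = normalized_jet_bounds[OF cm[OF t] ajet a01, folded c2_def c3_def c4_def Q_def]
    note mom = mean_power_moments[OF cm[OF t] ajet a01 t n, folded h_def c2_def c3_def c4_def]
    have moments: "has_bochner_integral (representing_measure h) (\<lambda>s. (s - t) ^ k) (C k)" if "k \<le> 4" for k
      using that by (rule le_4_cases) (use mom(2-) in \<open>simp_all add: C_def\<close>)
    have rep: "represents (representing_measure h) h" by (rule mom(1))
    have t0: "t \<ge> 0" using t by simp
    \<comment> \<open>The squared variance is at most the fourth central moment, so all fourth-order terms are bounded by \<open>Q\<close>.\<close>
    have C4: "C 4 \<le> 3 * t ^ 4 * Q / (real n)\<^sup>2"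
    proof -
      have "c4 + 3 * (real n - 1) * c2\<^sup>2 \<le> Q + 3 * (real n - 1) * Q"
        using bounds n0 by (intro add_mono mult_left_mono) auto
      also have "\<dots> \<le> 3 * real n * Q"
        using bounds n0 by (simp add: algebra_simps)
      finally have "t ^ 4 * (c4 + 3 * (real n - 1) * c2\<^sup>2) / real n ^ 3 \<le> t ^ 4 * (3 * real n * Q) / real n ^ 3"
        using t n0 by (intro divide_right_mono mult_left_mono) auto
      also have "\<dots> = 3 * t ^ 4 * Q / (real n)\<^sup>2"
        using n0 by (simp add: eval_nat_numeral)
      finally show ?thesis by (simp add: C_def)
    qed
    have C2: "C 2 \<ge> 0" using bounds t n0 by (simp add: C_def)
    have Q: "Q \<ge> 0" using bounds by (simp add: order_trans[OF zero_le_power2])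
    have sum3: "(\<Sum>i<3. C i *\<^sub>R (((- 1) ^ i / fact i) *\<^sub>R T t ((A ^^ i) x)))
      = T t x + (inverse (2 * real n) * c2 * t ^ 2) *\<^sub>R T t ((A ^^ 2) x)"
      by (simp add: eval_nat_numeral C_def field_simps)
    note Taylor = hille_phillips_Taylor[OF generator _ _ t0 rep moments]
    have meas: "(\<lambda>s. s) \<in> borel_measurable (representing_measure h)"
      by (rule represents_measurable_ident[OF rep])
    note third = third_absolute_moment_le[OF moments[of 2] moments[of 4] meas, simplified]
    have main: "norm (hille_phillips T h x - (T t x + (inverse (2 * real n) * c2 * t ^ 2) *\<^sub>R T t ((A ^^ 2) x)))
       \<le> M * C_const (g t) * t ^ 3 * real n powr (- 3 / 2) * norm ((A ^^ 3) x)"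
    proof -
      define K where "K = t ^ 3 * real n powr (- 3 / 2)"
      have K: "K \<ge> 0" using t by (simp add: K_def)
      have K2: "K\<^sup>2 = t ^ 6 / real n ^ 3"
      proof -
        have "(real n powr (- 3 / 2))\<^sup>2 = real n powr (- 3)"
          by (simp add: power2_eq_square flip: powr_add)
        also have "\<dots> = 1 / real n ^ 3"
          using n0 by (simp add: powr_minus_divide powr_numeral)
        finally show ?thesis by (simp add: K_def power_mult_distrib flip: power_mult)
      qed
      \<comment> \<open>The loss from \<open>6\<close> to \<open>36\<close> is the room between the constant \<open>\<surd>3/6\<close> that this argument gives
        and the claimed \<open>1/\<surd>2\<close>.\<close>
      have "C 2 * C 4 \<le> t\<^sup>2 * c2 / n * (3 * t ^ 4 * Q / (real n)\<^sup>2)"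
        using mult_left_mono[OF C4 C2] C_def[of 2] by simp
      also have "\<dots> = 6 * (c2 * Q / 2) * K\<^sup>2"
        unfolding K2 using n0 by (simp add: eval_nat_numeral)
      also have "\<dots> \<le> 36 * (c2 * Q / 2) * K\<^sup>2"
        using bounds Q by (intro mult_right_mono) auto
      also have "\<dots> = (6 * (sqrt (c2 * Q / 2) * K))\<^sup>2"
        using bounds Q by (simp add: power_mult_distrib)
      finally have "sqrt (C 2 * C 4) \<le> 6 * (sqrt (c2 * Q / 2) * K)"
        using K bounds Q by (intro real_le_lsqrt) auto
      then have int: "(\<integral>s. \<bar>s - t\<bar> ^ 3 \<partial>representing_measure h) \<le> 6 * (sqrt (c2 * Q / 2) * K)"
        using third(2) by linarith
      have "norm (hille_phillips T h x - (\<Sum>i<3. C i *\<^sub>R (((- 1) ^ i / fact i) *\<^sub>R T t ((A ^^ i) x))))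
          \<le> bound * (\<integral>s. \<bar>s - t\<bar> ^ 3 \<partial>representing_measure h) / fact 3 * norm ((A ^^ 3) x)"
        using x third(1) by (intro Taylor) auto
      also have "\<dots> \<le> bound * (6 * (sqrt (c2 * Q / 2) * K)) / fact 3 * norm ((A ^^ 3) x)"
        by (intro mult_right_mono divide_right_mono mult_left_mono int bound_nonneg) auto
      also have "\<dots> = M * C_const (g t) * t ^ 3 * real n powr (- 3 / 2) * norm ((A ^^ 3) x)"
        by (simp add: M C_const_def K_def c2_def Q_def a_def fact_numeral)
      finally show ?thesis unfolding sum3 .
    qed
    then show "?bound3 t n x"
      by (simp add: h_def c2_def a_def diff_diff_eq)
    assume x4: "x \<in> dom_power D A 4"
    let ?y = "hille_phillips T h x"
    let ?z = "T t x + (inverse (2 * real n) * c2 * t ^ 2) *\<^sub>R T t ((A ^^ 2) x)"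
    let ?w = "(C 3 / 6) *\<^sub>R T t ((A ^^ 3) x)"
    have sum4: "(\<Sum>i<4. C i *\<^sub>R (((- 1) ^ i / fact i) *\<^sub>R T t ((A ^^ i) x))) = ?z - ?w"
    proof -
      have "(\<Sum>i<4. C i *\<^sub>R (((- 1) ^ i / fact i) *\<^sub>R T t ((A ^^ i) x))) =
        (\<Sum>i<3. C i *\<^sub>R (((- 1) ^ i / fact i) *\<^sub>R T t ((A ^^ i) x))) +
        C 3 *\<^sub>R (((- 1) ^ 3 / fact 3) *\<^sub>R T t ((A ^^ 3) x))"
        using sum.lessThan_Suc[of "\<lambda>i. C i *\<^sub>R (((- 1) ^ i / fact i) *\<^sub>R T t ((A ^^ i) x))" 3]
        by (simp only: Suc_numeral semiring_norm)
      then show ?thesis unfolding sum3 by (simp add: fact_numeral)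
    qed
    have abs4: "\<bar>s - t\<bar> ^ 4 = (s - t) ^ 4" for s by (simp add: power_even_abs)
    have "norm (?y - (?z - ?w)) \<le>
        bound * (\<integral>s. \<bar>s - t\<bar> ^ 4 \<partial>representing_measure h) / fact 4 * norm ((A ^^ 4) x)"
      unfolding sum4[symmetric] using x4 moments[of 4]
      by (intro Taylor) (auto simp: abs4 has_bochner_integral_iff)
    also have "(\<integral>s. \<bar>s - t\<bar> ^ 4 \<partial>representing_measure h) = C 4"
      using moments[of 4] by (simp add: abs4 has_bochner_integral_iff)
    also have "bound * C 4 / fact 4 * norm ((A ^^ 4) x) \<le>
        bound * (3 * t ^ 4 * Q / (real n)\<^sup>2) / fact 4 * norm ((A ^^ 4) x)"
      by (intro mult_right_mono divide_right_mono mult_left_mono C4 bound_nonneg) auto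
    also have "\<dots> = 1 / 8 * (bound * Q * inverse (real n ^ 2) * t ^ 3 * (t * norm ((A ^^ 4) x)))"
      by (simp add: fact_numeral field_simps eval_nat_numeral)
    also have "\<dots> \<le> bound * Q * inverse (real n ^ 2) * t ^ 3 * (t * norm ((A ^^ 4) x))"
      using Q bound_nonneg t by simp
    finally have 1: "norm (?y - (?z - ?w)) \<le> bound * Q * inverse (real n ^ 2) * t ^ 3 * (t * norm ((A ^^ 4) x))" .
    have C3: "\<bar>C 3\<bar> / 6 \<le> t ^ 3 * Q / (real n)\<^sup>2"
    proof -
      have "\<bar>C 3\<bar> = t ^ 3 * \<bar>c3\<bar> / (real n)\<^sup>2"
        using t by (simp add: C_def abs_mult)
      also have "\<dots> \<le> t ^ 3 * Q / (real n)\<^sup>2"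
        using bounds t by (intro divide_right_mono mult_left_mono) auto
      finally show ?thesis using abs_ge_zero[of "C 3"] by linarith
    qed
    have "norm ?w \<le> \<bar>C 3\<bar> / 6 * (bound * norm ((A ^^ 3) x))"
      using norm_T_le[OF t0, of "(A ^^ 3) x"] by (simp add: mult_left_mono)
    also have "\<dots> \<le> t ^ 3 * Q / (real n)\<^sup>2 * (bound * norm ((A ^^ 3) x))"
      using bound_nonneg by (intro mult_right_mono C3) auto
    also have "\<dots> = bound * Q * inverse (real n ^ 2) * t ^ 3 * norm ((A ^^ 3) x)"
      by (simp only: divide_inverse ac_simps)
    finally have 2: "norm ?w \<le> bound * Q * inverse (real n ^ 2) * t ^ 3 * norm ((A ^^ 3) x)" .
    have "norm (?y - ?z) = norm (?y - (?z - ?w) - ?w)"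
      by (rule arg_cong[where f=norm]) (simp only: diff_diff_eq diff_add_cancel)
    also have "\<dots> \<le> norm (?y - (?z - ?w)) + norm ?w" by (rule norm_triangle_ineq4)
    also have "\<dots> \<le> bound * Q * inverse (real n ^ 2) * t ^ 3 * (norm ((A ^^ 3) x) + t * norm ((A ^^ 4) x))"
      unfolding distrib_left by (rule order_trans[OF add_mono[OF 1 2]]) simp
    finally show "norm (hille_phillips T (\<lambda>z. g t (t * z / real n) ^ n) x - T t x
          - (inverse (2 * real n) * (real_of_ereal (deriv_at_0 2 (g t)) - 1) * t ^ 2) *\<^sub>R T t ((A ^^ 2) x))
        \<le> M * C1_const (g t) * inverse (real n ^ 2) * t ^ 3 * (norm ((A ^^ 3) x) + t * norm ((A ^^ 4) x))"
      by (simp add: M h_def c2_def Q_def a_def C1_const_def diff_diff_eq)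
  qed
  moreover have "x \<in> dom_power D A 3" if "x \<in> dom_power D A 4" for x
    using that by (simp add: eval_nat_numeral)
  ultimately show ?thesis by blast
qed

end
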